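(* Let $\mu$ be a ULC probability measure on $\mathbb N^d$ with finite first moments. Then $\mu$ satisfies the weighted Wu-type modified log-Sobolev inequality with constant $1$: for every $f\in\mathcal A$, $$\mathrm{Ent}_\mu[f]\;\le\;\mathbf E_{\mathbf n\sim\mu}\Big[\sum_{i=1}^d\frac{(n_i+1)\,\mu(\mathbf n+\mathbf e_i)}{\mu(\mathbf n)}\,\Psi\big(f(\mathbf n),\nabla_i^+f(\mathbf n)\big)\Big]\;\le\;\mathcal E(\log f,f).$$
   Context: $\mathbb N=\{0,1,2,\dots\}$, $[d]=\{1,\dots,d\}$, $\mathbf e_i$ is the $i$-th standard basis vector, $\mathbf n!=\prod_{i=1}^d n_i!$. A set $S\subseteq\mathbb N^d$ is downward closed if $\mathbf n\in S$ and $\mathbf 0\le\mathbf m\le\mathbf n$ (coordinatewise) imply $\mathbf m\in S$. $\mathrm{supp}(\mu)=\{\mathbf n:\mu(\mathbf n)>0\}$. Definition (ULC). A probability measure $\mu$ on $\mathbb N^d$ with downward closed support is ULC (ultra-log-concave) if, with $a(\mathbf n)=\mathbf n!\,\mu(\mathbf n)$ and $\mathcal I_{\mathbf n}=\{i\in[d]:\mathbf n+\mathbf e_i\in\mathrm{supp}(\mu)\}$, for every $\mathbf n\in\mathrm{supp}(\mu)$ the matrix $$\Big(1-\frac{a(\mathbf n)\,a(\mathbf n+\mathbf e_i+\mathbf e_j)}{a(\mathbf n+\mathbf e_i)\,a(\mathbf n+\mathbf e_j)}\Big)_{i,j\in\mathcal I_{\mathbf n}}$$ is positive semidefinite. For $f:\mathrm{supp}(\mu)\to\mathbb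 R$, $\nabla_i^+f(\mathbf n)=f(\mathbf n+\mathbf e_i)-f(\mathbf n)$; terms with $\mathbf n+\mathbf e_i\notin\mathrm{supp}(\mu)$ have zero rate and are interpreted as $0$. $\mathrm{Ent}_\mu[f]=\mathbf E_\mu[f\log f]-\mathbf E_\mu[f]\log\mathbf E_\mu[f]$. $\Psi(u,v)=(u+v)\log(u+v)-u\log u-v(\log u+1)$, with $\Psi(0,0)=0$. The Dirichlet form is $$\mathcal E(f,g)=\mathbf E_{\mathbf n\sim\mu}\Big[\sum_{i=1}^d\frac{(n_i+1)\mu(\mathbf n+\mathbf e_i)}{\mu(\mathbf n)}\nabla_i^+f(\mathbf n)\,\nabla_i^+g(\mathbf n)\Big],$$ $\mathcal D(\mathcal E)=\{f\in L^2(\mu):\mathcal E(f,f)<\infty\}$, and $\mathcal A=\{f\in L^2(\mu): f>0,\ f\in\mathcal D(\mathcal E),\ \log f\in\mathcal D(\mathcal E)\}$. *)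

theory Defs
  imports "HOL-Probability.Probability"
begin

text \<open>
  A probability measure on \<open>\<nat>\<^sup>d\<close> is a \<open>pmf\<close> on \<open>nat ^ 'd\<close>, where \<open>d = CARD('d)\<close>. The vector \<open>axis i 1\<close>
  is the \<open>i\<close>-th standard basis vector, the order on \<open>nat ^ 'd\<close> is coordinatewise, and \<open>set_pmf \<mu>\<close>
  is \<open>supp(\<mu>)\<close>.
\<close>

definition downward_closed :: "(nat ^ 'd::finite) set \<Rightarrow> bool" where
  "downward_closed S \<longleftrightarrow> (\<forall>n\<in>S. \<forall>m. 0 \<le> m \<and> m \<le> n \<longrightarrow> m \<in> S)"

definition vfact :: "nat ^ 'd::finite \<Rightarrow> nat" where
  "vfact n = (\<Prod>i\<in>UNIV. fact (n $ i))"

definition psd_on :: "'i set \<Rightarrow> ('i \<Rightarrow> 'i \<Rightarrow> real) \<Rightarrow> bool" where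
  "psd_on I M \<longleftrightarrow>
     (\<forall>i\<in>I. \<forall>j\<in>I. M i j = M j i) \<and>
     (\<forall>x. 0 \<le> (\<Sum>i\<in>I. \<Sum>j\<in>I. x i * M i j * x j))"

definition fact_weight :: "(nat ^ 'd::finite) pmf \<Rightarrow> nat ^ 'd \<Rightarrow> real" where
  "fact_weight \<mu> n = real (vfact n) * pmf \<mu> n"

definition up_dirs :: "(nat ^ 'd::finite) pmf \<Rightarrow> nat ^ 'd \<Rightarrow> 'd set" where
  "up_dirs \<mu> n = {i. n + axis i 1 \<in> set_pmf \<mu>}"

definition ULC :: "(nat ^ 'd::finite) pmf \<Rightarrow> bool" where
  "ULC \<mu> \<longleftrightarrow>
     downward_closed (set_pmf \<mu>) \<and>
     (\<forall>n\<in>set_pmf \<mu>. psd_on (up_dirs \<mu> n)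
        (\<lambda>i j. 1 - fact_weight \<mu> n * fact_weight \<mu> (n + axis i 1 + axis j 1) /
                   (fact_weight \<mu> (n + axis i 1) * fact_weight \<mu> (n + axis j 1))))"

definition finite_first_moments :: "(nat ^ 'd::finite) pmf \<Rightarrow> bool" where
  "finite_first_moments \<mu> \<longleftrightarrow> (\<forall>i. integrable (measure_pmf \<mu>) (\<lambda>n. real (n $ i)))"

text \<open>
  Functions \<open>supp(\<mu>) \<rightarrow> \<real>\<close> are represented by total functions on \<open>nat ^ 'd\<close>. Their values off the
  support play no role: expectations ignore points outside the support, and the rate below
  vanishes when \<open>n + axis i 1\<close> lies outside it.
\<close>

definition grad_plus :: "'d \<Rightarrow> (nat ^ 'd::finite \<Rightarrow> real) \<Rightarrow> nat ^ 'd \<Rightarrow> real" where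
  "grad_plus i f n = f (n + axis i 1) - f n"

definition rate :: "(nat ^ 'd::finite) pmf \<Rightarrow> 'd \<Rightarrow> nat ^ 'd \<Rightarrow> real" where
  "rate \<mu> i n = (real (n $ i) + 1) * pmf \<mu> (n + axis i 1) / pmf \<mu> n"

definition dirichlet_integrand ::
    "(nat ^ 'd::finite) pmf \<Rightarrow> (nat ^ 'd \<Rightarrow> real) \<Rightarrow> (nat ^ 'd \<Rightarrow> real) \<Rightarrow> nat ^ 'd \<Rightarrow> real" where
  "dirichlet_integrand \<mu> f g n = (\<Sum>i\<in>UNIV. rate \<mu> i n * grad_plus i f n * grad_plus i g n)"

definition dirichlet_form ::
    "(nat ^ 'd::finite) pmf \<Rightarrow> (nat ^ 'd \<Rightarrow> real) \<Rightarrow> (nat ^ 'd \<Rightarrow> real) \<Rightarrow> real" where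
  "dirichlet_form \<mu> f g = measure_pmf.expectation \<mu> (dirichlet_integrand \<mu> f g)"

definition L2 :: "(nat ^ 'd::finite) pmf \<Rightarrow> (nat ^ 'd \<Rightarrow> real) set" where
  "L2 \<mu> = {f. integrable (measure_pmf \<mu>) (\<lambda>n. (f n)\<^sup>2)}"

text \<open>The condition \<open>\<E>(f, f) < \<infinity>\<close> is stated for the \<open>[0, \<infinity>]\<close>-valued integral.\<close>

definition dirichlet_domain :: "(nat ^ 'd::finite) pmf \<Rightarrow> (nat ^ 'd \<Rightarrow> real) set" where
  "dirichlet_domain \<mu> =
     {f \<in> L2 \<mu>. (\<integral>\<^sup>+n. ennreal (dirichlet_integrand \<mu> f f n) \<partial>measure_pmf \<mu>) < \<infinity>}"

definition admissible :: "(nat ^ 'd::finite) pmf \<Rightarrow> (nat ^ 'd \<Rightarrow> real) set" where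
  "admissible \<mu> =
     {f \<in> L2 \<mu>. (\<forall>n\<in>set_pmf \<mu>. f n > 0) \<and>
        f \<in> dirichlet_domain \<mu> \<and> (\<lambda>n. ln (f n)) \<in> dirichlet_domain \<mu>}"

definition Ent :: "(nat ^ 'd::finite) pmf \<Rightarrow> (nat ^ 'd \<Rightarrow> real) \<Rightarrow> real" where
  "Ent \<mu> f = measure_pmf.expectation \<mu> (\<lambda>n. f n * ln (f n)) -
             measure_pmf.expectation \<mu> f * ln (measure_pmf.expectation \<mu> f)"

text \<open>As \<open>ln 0 = 0\<close>, the formula already gives the convention \<open>\<Psi>(0, 0) = 0\<close>.\<close>

definition \<Psi> :: "real \<Rightarrow> real \<Rightarrow> real" where
  "\<Psi> u v = (u + v) * ln (u + v) - u * ln u - v * (ln u + 1)"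

definition wu_integrand ::
    "(nat ^ 'd::finite) pmf \<Rightarrow> (nat ^ 'd \<Rightarrow> real) \<Rightarrow> nat ^ 'd \<Rightarrow> real" where
  "wu_integrand \<mu> f n = (\<Sum>i\<in>UNIV. rate \<mu> i n * \<Psi> (f n) (grad_plus i f n))"

text \<open>
  For admissible \<open>f\<close> the expectations in the entropy and in \<open>\<E>(log f, f)\<close> are those of integrable
  functions, so the value \<open>0\<close> of the Bochner integral of a non-integrable function never enters.
  For \<open>wu_integrand\<close> this is less immediate, and integrability is part of the theorem's conclusion.
\<close>

lemma rate_nonneg: "0 \<le> rate \<mu> i n"
  by (simp add: rate_def)

lemma abs_mult_le_squares: "\<bar>a * b\<bar> \<le> a * a + b * b" for a b :: real
proof -
  have "0 \<le> (a + b)\<^sup>2 + (a\<^sup>2 + b\<^sup>2)" "0 \<le> (a - b)\<^sup>2 + (a\<^sup>2 + b\<^sup>2)" by simp_all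
  then show ?thesis by (simp add: abs_le_iff power2_eq_square algebra_simps)
qed

lemma integrable_dirichlet_integrand_self:
  assumes "f \<in> dirichlet_domain \<mu>"
  shows "integrable (measure_pmf \<mu>) (dirichlet_integrand \<mu> f f)"
proof (rule integrableI_nonneg)
  show "AE n in measure_pmf \<mu>. 0 \<le> dirichlet_integrand \<mu> f f n"
    by (simp add: dirichlet_integrand_def mult.assoc sum_nonneg rate_nonneg)
qed (use assms in \<open>auto simp: dirichlet_domain_def\<close>)

lemma integrable_dirichlet_integrand:
  assumes "f \<in> dirichlet_domain \<mu>" "g \<in> dirichlet_domain \<mu>"
  shows "integrable (measure_pmf \<mu>) (dirichlet_integrand \<mu> f g)"
proof (rule Bochner_Integration.integrable_bound)
  show "integrable (measure_pmf \<mu>) (\<lambda>n. dirichlet_integrand \<mu> f f n + dirichlet_integrand \<mu> g g n)"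
    using assms by (intro Bochner_Integration.integrable_add integrable_dirichlet_integrand_self)
  have "\<bar>dirichlet_integrand \<mu> f g n\<bar> \<le> dirichlet_integrand \<mu> f f n + dirichlet_integrand \<mu> g g n" for n
  proof -
    have "\<bar>dirichlet_integrand \<mu> f g n\<bar> \<le> (\<Sum>i\<in>UNIV. rate \<mu> i n * \<bar>grad_plus i f n * grad_plus i g n\<bar>)"
      unfolding dirichlet_integrand_def
      by (rule order_trans[OF sum_abs]) (simp add: abs_mult rate_nonneg mult.assoc)
    also have "\<dots> \<le> (\<Sum>i\<in>UNIV. rate \<mu> i n *
        (grad_plus i f n * grad_plus i f n + grad_plus i g n * grad_plus i g n))"
      by (intro sum_mono mult_left_mono abs_mult_le_squares rate_nonneg)
    finally show ?thesis
      by (simp add: dirichlet_integrand_def sum.distrib algebra_simps)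
  qed
  then show "AE n in measure_pmf \<mu>. norm (dirichlet_integrand \<mu> f g n)
      \<le> norm (dirichlet_integrand \<mu> f f n + dirichlet_integrand \<mu> g g n)"
    by (auto intro: order_trans[OF _ abs_ge_self])
qed simp

lemma admissible_integrable:
  assumes "f \<in> admissible \<mu>"
  shows "integrable (measure_pmf \<mu>) f"
    and "integrable (measure_pmf \<mu>) (\<lambda>n. f n * ln (f n))"
    and "integrable (measure_pmf \<mu>) (dirichlet_integrand \<mu> (\<lambda>n. ln (f n)) f)"
proof -
  have sq: "integrable (measure_pmf \<mu>) (\<lambda>n. (f n)\<^sup>2)"
    and sql: "integrable (measure_pmf \<mu>) (\<lambda>n. (ln (f n))\<^sup>2)"
    using assms by (auto simp: admissible_def dirichlet_domain_def L2_def)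
  show "integrable (measure_pmf \<mu>) f"
    by (rule measure_pmf.square_integrable_imp_integrable[OF _ sq]) simp
  show "integrable (measure_pmf \<mu>) (\<lambda>n. f n * ln (f n))"
  proof (rule Bochner_Integration.integrable_bound)
    show "integrable (measure_pmf \<mu>) (\<lambda>n. (f n)\<^sup>2 + (ln (f n))\<^sup>2)"
      using sq sql by (rule Bochner_Integration.integrable_add)
    show "AE n in measure_pmf \<mu>. norm (f n * ln (f n)) \<le> norm ((f n)\<^sup>2 + (ln (f n))\<^sup>2)"
      using abs_mult_le_squares by (simp add: power2_eq_square)
  qed simp
  show "integrable (measure_pmf \<mu>) (dirichlet_integrand \<mu> (\<lambda>n. ln (f n)) f)"
    using assms by (intro integrable_dirichlet_integrand) (auto simp: admissible_def)
qed

end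

theory Submission
  imports Defs "HOL-Real_Asymp.Real_Asymp"
begin

text \<open>
  Entropy is interpolated along binomial thinning. Let \<open>a(n) = n! \<mu>(n)\<close>, first for finitely supported
  \<open>\<mu>\<close>, let \<open>T a(n) = \<Sum>\<^sub>i a(n + e\<^sub>i)\<close>, and put \<open>A\<^sub>t = exp((1 - t) T) a\<close>, \<open>B\<^sub>t = exp((1 - t) T) (a f)\<close>. The
  weights \<open>t^|n| A\<^sub>t(n) / n!\<close> are the law of the \<open>t\<close>-thinning of \<open>\<mu>\<close>, and \<open>B\<^sub>t / A\<^sub>t\<close> is the conditional
  expectation of \<open>f\<close>. The entropy of \<open>B\<^sub>t / A\<^sub>t\<close> under this law has as \<open>t\<close>-derivative the Wu functional
  \<open>D(t)\<close> of \<open>A\<^sub>t\<close>, \<open>B\<^sub>t\<close>, so it suffices that \<open>D\<close> is nondecreasing: then \<open>Ent\<^sub>\<mu>[f]\<close>, the integral of \<open>D\<close> over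
  \<open>[0, 1]\<close>, is at most \<open>D(1)\<close>. The inequality \<open>x log (x / y) - x \<ge> -y\<close> bounds \<open>D'\<close> below, pointwise in
  \<open>n\<close>, by the quadratic form of the ULC matrix of \<open>A\<^sub>t\<close>.

  That \<open>A\<^sub>t\<close> is again ULC follows from \<open>exp(s T) = lim (1 + (s/N) T)^N\<close>, since each Euler step
  \<open>1 + \<epsilon> T\<close> with \<open>\<epsilon>\<close> small preserves ULC by Cauchy-Schwarz. General \<open>\<mu>\<close> are truncated to
  \<open>|n| < K\<close>, which keeps ULC because the matrix becomes all-ones on the top layer, and \<open>K \<rightarrow> \<infinity>\<close>.
\<close>

text \<open>Otherwise \<open>axis i 1\<close> is rewritten to \<open>axis i (Suc 0)\<close>.\<close>
declare One_nat_def [simp del]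

section \<open>Weights on the lattice and the shift operator \<open>T\<close>\<close>

definition deg :: "nat ^ 'd::finite \<Rightarrow> nat" where
  "deg x = (\<Sum>i\<in>UNIV. x $ i)"

definition shift_sum :: "(nat ^ 'd::finite \<Rightarrow> real) \<Rightarrow> nat ^ 'd \<Rightarrow> real" where
  "shift_sum a x = (\<Sum>i\<in>UNIV. a (x + axis i 1))"

text \<open>The second clause says that the support is downward closed.\<close>
definition weight :: "nat \<Rightarrow> (nat ^ 'd::finite \<Rightarrow> real) \<Rightarrow> bool" where
  "weight K a \<longleftrightarrow> (\<forall>x. 0 \<le> a x) \<and> (\<forall>x i. a x = 0 \<longrightarrow> a (x + axis i 1) = 0) \<and> (\<forall>x. K \<le> deg x \<longrightarrow> a x = 0)"

text \<open>The ULC condition with denominators cleared, by scaling the test vector: \<open>v i\<close> here is \<open>x i / a (x + e\<^sub>i)\<close> there.\<close>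
definition log_conc :: "(nat ^ 'd::finite \<Rightarrow> real) \<Rightarrow> bool" where
  "log_conc a \<longleftrightarrow> (\<forall>x v. a x * (\<Sum>i\<in>UNIV. \<Sum>j\<in>UNIV. v i * v j * a (x + axis i 1 + axis j 1))
     \<le> (\<Sum>i\<in>UNIV. v i * a (x + axis i 1))\<^sup>2)"

definition euler_step :: "real \<Rightarrow> (nat ^ 'd::finite \<Rightarrow> real) \<Rightarrow> nat ^ 'd \<Rightarrow> real" where
  "euler_step \<epsilon> a x = a x + \<epsilon> * shift_sum a x"

text \<open>The exponential series of \<open>T\<close>, cut at \<open>K\<close> terms. For
  \<open>weight K a\<close> nothing is lost, as \<open>shift_sum_iter_deg\<close> makes all later
  terms vanish, and the result is a polynomial in \<open>s\<close>.\<close>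

definition shift_exp :: "nat \<Rightarrow> real \<Rightarrow> (nat ^ 'd::finite \<Rightarrow> real) \<Rightarrow> nat ^ 'd \<Rightarrow> real" where
  "shift_exp K s a x = (\<Sum>m<K. s ^ m / fact m * (shift_sum ^^ m) a x)"

lemma weightD:
  assumes "weight K a"
  shows "0 \<le> a x" "a x = 0 \<Longrightarrow> a (x + axis i 1) = 0" "K \<le> deg x \<Longrightarrow> a x = 0"
  using assms by (auto simp: weight_def)

lemma deg_add_axis [simp]: "deg (x + axis i (1::nat)) = Suc (deg x)"
proof -
  have "(\<Sum>j\<in>UNIV. (axis i (1::nat) :: nat ^ 'a) $ j) = (\<Sum>j\<in>UNIV. if j = i then 1 else 0)"
    by (intro sum.cong) (auto simp: axis_def)
  then show ?thesis by (simp add: deg_def sum.distrib)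
qed

lemma deg_eq_0_iff [simp]: "deg x = 0 \<longleftrightarrow> x = 0"
  by (simp add: deg_def vec_eq_iff)

lemma deg_0 [simp]: "deg 0 = 0"
  by simp

lemma nth_le_deg: "x $ i \<le> deg x"
  unfolding deg_def by (rule member_le_sum) auto

lemma finite_deg_less: "finite {x :: nat ^ 'd::finite. deg x < K}"
proof (rule finite_imageD)
  have "vec_nth ` {x :: nat ^ 'd. deg x < K} \<subseteq> PiE UNIV (\<lambda>_. {..<K})"
    using le_less_trans[OF nth_le_deg] by auto
  moreover have "finite (PiE (UNIV :: 'd set) (\<lambda>_. {..<K}))"
    by (intro finite_PiE) auto
  ultimately show "finite (vec_nth ` {x :: nat ^ 'd. deg x < K})"
    by (rule finite_subset)
  show "inj_on vec_nth {x :: nat ^ 'd. deg x < K}"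
    by (auto simp: inj_on_def vec_eq_iff)
qed

lemma vfact_add_axis: "vfact (x + axis i (1::nat)) = Suc (x $ i) * vfact x"
proof -
  have "vfact (x + axis i (1::nat)) = (\<Prod>j\<in>UNIV. (if j = i then Suc (x $ i) else 1) * fact (x $ j))"
    unfolding vfact_def by (intro prod.cong) (auto simp: axis_def simp flip: Suc_eq_plus1)
  then show ?thesis by (simp add: prod.distrib vfact_def)
qed

lemma vfact_neq_0 [simp]: "vfact x \<noteq> 0"
  by (simp add: vfact_def)

lemma weight_shift_sum:
  assumes "weight K a"
  shows "weight K (shift_sum a)"
  unfolding weight_def
proof (intro conjI allI impI)
  show "0 \<le> shift_sum a x" for x
    using weightD(1)[OF assms] by (simp add: shift_sum_def sum_nonneg)
  show "shift_sum a (x + axis i 1) = 0" if "shift_sum a x = 0" for x i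
  proof -
    have "a (x + axis j 1) = 0" for j
      using that weightD(1)[OF assms] by (simp add: shift_sum_def sum_nonneg_eq_0_iff)
    then show ?thesis
      using weightD(2)[OF assms] by (simp add: shift_sum_def)
  qed
  show "shift_sum a x = 0" if "K \<le> deg x" for x
    using that weightD(3)[OF assms] by (simp add: shift_sum_def)
qed

lemma weight_shift_sum_iter: "weight K a \<Longrightarrow> weight K ((shift_sum ^^ m) a)"
  by (induction m) (auto simp: weight_shift_sum)

lemma shift_sum_eq_0: "weight K a \<Longrightarrow> a x = 0 \<Longrightarrow> shift_sum a x = 0"
  by (simp add: shift_sum_def weightD(2))

lemma shift_sum_iter_eq_0: "weight K a \<Longrightarrow> a x = 0 \<Longrightarrow> (shift_sum ^^ m) a x = 0"
  by (induction m) (auto intro: shift_sum_eq_0 weight_shift_sum_iter)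

text \<open>Each shift looks one degree higher, so the \<open>m\<close>-th iterate at
  \<open>x\<close> only reads values of \<open>a\<close> in degree \<open>deg x + m\<close>. In
  particular \<open>T\<close> is nilpotent on these weights.\<close>

lemma shift_sum_iter_deg: "weight K a \<Longrightarrow> K \<le> deg x + m \<Longrightarrow> (shift_sum ^^ m) a x = 0"
proof (induction m arbitrary: x)
  case 0
  then show ?case by (simp add: weightD)
next
  case (Suc m)
  then show ?case by (simp add: shift_sum_def)
qed

section \<open>Euler steps preserve ULC\<close>

lemma weight_euler_step:
  assumes "weight K a" "\<epsilon> \<ge> 0"
  shows "weight K (euler_step \<epsilon> a)"
proof -
  have "a x = 0 \<and> \<epsilon> * shift_sum a x = 0" if "euler_step \<epsilon> a x = 0" for x
  proof -
    have "0 \<le> \<epsilon> * shift_sum a x" "0 \<le> a x"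
      using assms weightD(1)[OF weight_shift_sum[OF assms(1)], of x] weightD(1) by auto
    then show ?thesis using that unfolding euler_step_def by linarith
  qed
  moreover have "shift_sum a (x + axis i 1) = 0" if "a x = 0" for x i
    using that assms(1) shift_sum_eq_0 weightD(2) by blast
  ultimately show ?thesis
    using assms weightD[OF assms(1)] weightD[OF weight_shift_sum[OF assms(1)]]
    unfolding weight_def by (auto simp: euler_step_def)
qed

text \<open>
  In the notation of the proof, \<open>\<beta>\<close> is the value at \<open>v\<close> of the quadratic form \<open>p\<^sup>2 - F Q\<close>. Cauchy-Schwarz
  for this form against the \<open>k\<close>-th unit vector bounds \<open>\<delta> k\<close>, the deviation of \<open>q k / Fk k\<close> from \<open>p / F\<close>,
  by a multiple of \<open>\<beta>\<close>, so the defect created by mixing the forms at \<open>x\<close> and \<open>x + e\<^sub>k\<close> is absorbed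
  by \<open>\<beta>\<close>.
\<close>
lemma log_conc_euler_step:
  assumes w: "weight K a" and lc: "log_conc a"
    and R: "\<And>x. shift_sum a x \<le> R * a x" and \<epsilon>: "0 \<le> \<epsilon>" "\<epsilon> * R \<le> 1"
  shows "log_conc (euler_step \<epsilon> a)"
  unfolding log_conc_def
proof (intro allI)
  fix x :: "nat ^ 'a" and v :: "'a \<Rightarrow> real"
  let ?e = "\<lambda>i::'a. axis i (1::nat)"
  show "euler_step \<epsilon> a x * (\<Sum>i\<in>UNIV. \<Sum>j\<in>UNIV. v i * v j * euler_step \<epsilon> a (x + ?e i + ?e j))
     \<le> (\<Sum>i\<in>UNIV. v i * euler_step \<epsilon> a (x + ?e i))\<^sup>2"
  proof (cases "a x = 0")
    case True
    then show ?thesis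
      using shift_sum_eq_0[OF w] by (simp add: euler_step_def)
  next
    case False
    define F where "F = a x"
    have F: "F > 0" using False weightD(1)[OF w, of x] by (simp add: F_def)
    define Fk where "Fk k = a (x + ?e k)" for k
    define p where "p = (\<Sum>i\<in>UNIV. v i * a (x + ?e i))"
    define q where "q k = (\<Sum>i\<in>UNIV. v i * a (x + ?e i + ?e k))" for k
    define Q where "Q = (\<Sum>i\<in>UNIV. \<Sum>j\<in>UNIV. v i * v j * a (x + ?e i + ?e j))"
    define Qk where "Qk k = (\<Sum>i\<in>UNIV. \<Sum>j\<in>UNIV. v i * v j * a (x + ?e k + ?e i + ?e j))" for k
    define \<beta> where "\<beta> = p\<^sup>2 - F * Q"
    have Fk0: "Fk k \<ge> 0" for k using weightD(1)[OF w] by (simp add: Fk_def)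
    have comm: "x + ?e i + ?e k = x + ?e k + ?e i" for i k by (simp add: add_ac)
    have QQ: "Fk k * Qk k \<le> (q k)\<^sup>2" for k
      using lc unfolding log_conc_def Fk_def Qk_def q_def by (subst comm) blast
    have CS: "(p * Fk k - F * q k)\<^sup>2 \<le> \<beta> * (Fk k)\<^sup>2" for k
    proof (cases "Fk k = 0")
      case True
      then have "a (x + ?e i + ?e k) = 0" for i
        using weightD(2)[OF w] unfolding Fk_def comm[of i] by blast
      then show ?thesis by (simp add: True q_def)
    next
      case False
      define \<gamma> where "\<gamma> = p * Fk k - F * q k"
      define \<kappa> where "\<kappa> = a (x + ?e k + ?e k)"
      have \<kappa>: "\<kappa> \<ge> 0" using weightD(1)[OF w] by (simp add: \<kappa>_def)
      \<comment> \<open>Nonnegativity of the form at \<open>v\<close> plus \<open>l\<close> times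
        the \<open>k\<close>-th unit vector; \<open>\<gamma>\<close> is its polarisation between
        these two vectors.\<close>
      have expand: "0 \<le> \<beta> + 2 * l * \<gamma> + l\<^sup>2 * ((Fk k)\<^sup>2 - F * \<kappa>)" for l
      proof -
        let ?d = "\<lambda>i. if i = k then l else 0"
        have s1: "(\<Sum>i\<in>UNIV. (v i + ?d i) * a (x + ?e i)) = p + l * Fk k"
          by (simp add: p_def Fk_def distrib_right sum.distrib if_distrib[of "\<lambda>t. t * _"] cong: if_cong)
        have s2: "(\<Sum>i\<in>UNIV. \<Sum>j\<in>UNIV. (v i + ?d i) * (v j + ?d j) * a (x + ?e i + ?e j))
            = Q + 2 * l * q k + l\<^sup>2 * \<kappa>"
        proof -
          have "(\<Sum>i\<in>UNIV. \<Sum>j\<in>UNIV. (v i + ?d i) * (v j + ?d j) * a (x + ?e i + ?e j))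
            = (\<Sum>i\<in>UNIV. \<Sum>j\<in>UNIV. v i * v j * a (x + ?e i + ?e j)
               + (if j = k then l * v i * a (x + ?e i + ?e j) else 0)
               + (if i = k then l * v j * a (x + ?e i + ?e j) else 0)
               + (if i = k then if j = k then l\<^sup>2 * a (x + ?e i + ?e j) else 0 else 0))"
            by (intro sum.cong refl) (auto simp: algebra_simps power2_eq_square)
          also have "\<dots> = Q + (\<Sum>i\<in>UNIV. l * v i * a (x + ?e i + ?e k))
              + (\<Sum>j\<in>UNIV. l * v j * a (x + ?e k + ?e j)) + l\<^sup>2 * \<kappa>"
          proof -
            have *: "(\<Sum>i\<in>UNIV. \<Sum>j\<in>UNIV. if i = k then h j else 0) = (\<Sum>j\<in>UNIV. h j)" for h :: "'a \<Rightarrow> real"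
              by (subst sum.swap) simp
            have **: "(\<Sum>i\<in>UNIV. \<Sum>j\<in>UNIV. if i = k then l * v j * a (x + ?e i + ?e j) else 0) = 
              (\<Sum>j\<in>UNIV. l * v j * a (x + ?e k + ?e j))"
              by (subst *[symmetric]) (intro sum.cong, auto)
            have ***: "(\<Sum>i\<in>UNIV. \<Sum>j\<in>UNIV. if i = k then if j = k then l\<^sup>2 * a (x + ?e i + ?e j) else 0 else 0) = l\<^sup>2 * \<kappa>"
              using *[of "\<lambda>j. if j = k then l\<^sup>2 * a (x + ?e k + ?e j) else 0"]
              by (simp add: \<kappa>_def if_distrib cong: if_cong)
            show ?thesis unfolding sum.distrib ** *** by (simp add: Q_def)
          qed
          also have "(\<Sum>j\<in>UNIV. l * v j * a (x + ?e k + ?e j)) = (\<Sum>i\<in>UNIV. l * v i * a (x + ?e i + ?e k))"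
            by (subst comm) simp
          finally show ?thesis by (simp add: q_def sum_distrib_left mult.assoc)
        qed
        have "F * (Q + 2 * l * q k + l\<^sup>2 * \<kappa>) \<le> (p + l * Fk k)\<^sup>2"
          using lc[unfolded log_conc_def, rule_format, of x "\<lambda>i. v i + ?d i"] unfolding s1 s2 F_def .
        then show ?thesis by (simp add: \<beta>_def \<gamma>_def power2_eq_square algebra_simps)
      qed
      \<comment> \<open>Minimiser of the quadratic in \<open>l\<close> after discarding \<open>F * \<kappa>\<close>.\<close>
      define l where "l = - \<gamma> / (Fk k)\<^sup>2"
      have "0 \<le> \<beta> + 2 * l * \<gamma> + l\<^sup>2 * ((Fk k)\<^sup>2 - F * \<kappa>)" by (rule expand)
      also have "\<dots> \<le> \<beta> + 2 * l * \<gamma> + l\<^sup>2 * (Fk k)\<^sup>2"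
        using \<kappa> F by (intro add_left_mono mult_left_mono) auto
      also have "\<dots> = \<beta> - \<gamma>\<^sup>2 / (Fk k)\<^sup>2"
        using False by (simp add: l_def field_simps power2_eq_square)
      finally show ?thesis using False by (simp add: \<gamma>_def field_simps)
    qed
    define r where "r = p / F"
    define \<delta> where "\<delta> k = q k - r * Fk k" for k
    have CS': "(\<delta> k)\<^sup>2 \<le> \<beta> * (Fk k)\<^sup>2 / F\<^sup>2" for k
    proof -
      have "\<delta> k = - (p * Fk k - F * q k) / F" using F by (simp add: \<delta>_def r_def field_simps)
      then have "(\<delta> k)\<^sup>2 = (p * Fk k - F * q k)\<^sup>2 / F\<^sup>2"
        by (simp only: power_divide power2_minus)
      then show ?thesis using CS[of k] F by (simp add: divide_right_mono)
    qed
    have Qk: "Qk k \<le> r\<^sup>2 * Fk k + 2 * r * \<delta> k + \<beta> * Fk k / F\<^sup>2" for k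
    proof (cases "Fk k = 0")
      case True
      then have "a (x + ?e k + ?e i) = 0" for i
        using weightD(2)[OF w] unfolding Fk_def by blast
      moreover then have "a (x + ?e k + ?e i + ?e j) = 0" for i j
        using weightD(2)[OF w] by blast
      ultimately show ?thesis using comm[of _ k] by (simp add: True Qk_def q_def \<delta>_def)
    next
      case False
      then have pos: "Fk k > 0" using Fk0[of k] by simp
      have "Fk k * Qk k \<le> (r * Fk k + \<delta> k)\<^sup>2" using QQ[of k] by (simp add: \<delta>_def)
      also have "\<dots> \<le> r\<^sup>2 * (Fk k)\<^sup>2 + 2 * r * \<delta> k * Fk k + \<beta> * (Fk k)\<^sup>2 / F\<^sup>2"
        using CS'[of k] by (simp add: power2_eq_square algebra_simps)
      also have "\<dots> = Fk k * (r\<^sup>2 * Fk k + 2 * r * \<delta> k + \<beta> * Fk k / F\<^sup>2)"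
        by (simp add: power2_eq_square algebra_simps)
      finally show ?thesis using pos by simp
    qed
    have \<beta>0: "\<beta> \<ge> 0" using lc by (auto simp: \<beta>_def p_def F_def Q_def log_conc_def)
    define SF where "SF = (\<Sum>k\<in>UNIV. Fk k)"
    define SD where "SD = (\<Sum>k\<in>UNIV. \<delta> k)"
    \<comment> \<open>Here the step size enters: \<open>R\<close> bounds the ratio of
      \<open>shift_sum a x\<close> to \<open>a x\<close>, so the weight that the mixture takes from
      the neighbours is at most \<open>F\<close>.\<close>
    have SF: "\<epsilon> * SF \<le> F"
    proof -
      have "\<epsilon> * SF \<le> \<epsilon> * (R * F)"
        using R[of x] \<epsilon> by (intro mult_left_mono) (auto simp: SF_def F_def Fk_def shift_sum_def)
      also have "\<dots> \<le> 1 * F" unfolding mult.assoc[symmetric] using \<epsilon> F by (intro mult_right_mono) auto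
      finally show ?thesis by simp
    qed
    have "\<epsilon> * (\<Sum>k\<in>UNIV. Qk k) \<le> \<epsilon> * (\<Sum>k\<in>UNIV. r\<^sup>2 * Fk k + 2 * r * \<delta> k + \<beta> * Fk k / F\<^sup>2)"
      using \<epsilon> Qk by (intro mult_left_mono sum_mono)
    also have "(\<Sum>k\<in>UNIV. r\<^sup>2 * Fk k + 2 * r * \<delta> k + \<beta> * Fk k / F\<^sup>2) = r\<^sup>2 * SF + 2 * r * SD + \<beta> * SF / F\<^sup>2"
      by (simp add: sum.distrib SF_def SD_def sum_distrib_left sum_divide_distrib)
    also have "\<epsilon> * \<dots> = r\<^sup>2 * (\<epsilon> * SF) + 2 * r * \<epsilon> * SD + \<beta> * (\<epsilon> * SF) / F\<^sup>2"
      by (simp add: algebra_simps)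
    also have "\<dots> \<le> r\<^sup>2 * (\<epsilon> * SF) + 2 * r * \<epsilon> * SD + \<beta> * F / F\<^sup>2"
      using SF \<beta>0 by (intro add_left_mono divide_right_mono mult_left_mono) auto
    \<comment> \<open>The accumulated error is at most \<open>\<beta> / F\<close>, and this contains
      exactly the \<open>- Q\<close> that cancels the unperturbed form.\<close>
    also have "\<beta> * F / F\<^sup>2 = r\<^sup>2 * F - Q"
      using F by (simp add: \<beta>_def r_def field_simps power2_eq_square)
    finally have "Q + \<epsilon> * (\<Sum>k\<in>UNIV. Qk k) \<le> r\<^sup>2 * (F + \<epsilon> * SF) + 2 * r * (\<epsilon> * SD)"
      by (simp add: algebra_simps)
    moreover have SF0: "0 \<le> F + \<epsilon> * SF"
      using F \<epsilon> Fk0 by (auto simp: SF_def intro!: add_nonneg_nonneg mult_nonneg_nonneg sum_nonneg)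
    ultimately have "(F + \<epsilon> * SF) * (Q + \<epsilon> * (\<Sum>k\<in>UNIV. Qk k))
        \<le> (F + \<epsilon> * SF) * (r\<^sup>2 * (F + \<epsilon> * SF) + 2 * r * (\<epsilon> * SD))"
      by (intro mult_left_mono)
    \<comment> \<open>The added term completes the square.\<close>
    also have "\<dots> \<le> (F + \<epsilon> * SF) * (r\<^sup>2 * (F + \<epsilon> * SF) + 2 * r * (\<epsilon> * SD)) + (\<epsilon> * SD)\<^sup>2"
      by simp
    also have "\<dots> = (r * (F + \<epsilon> * SF) + \<epsilon> * SD)\<^sup>2"
      by (simp add: power2_eq_square algebra_simps)
    also have "r * (F + \<epsilon> * SF) + \<epsilon> * SD = p + \<epsilon> * (\<Sum>k\<in>UNIV. q k)"
      using F by (simp add: SF_def SD_def \<delta>_def r_def sum_subtractf sum_distrib_left algebra_simps)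
    finally have main: "(F + \<epsilon> * SF) * (Q + \<epsilon> * (\<Sum>k\<in>UNIV. Qk k)) \<le> (p + \<epsilon> * (\<Sum>k\<in>UNIV. q k))\<^sup>2" .
    have e1: "euler_step \<epsilon> a x = F + \<epsilon> * SF"
      by (simp add: euler_step_def F_def SF_def Fk_def shift_sum_def)
    have e2: "(\<Sum>i\<in>UNIV. v i * euler_step \<epsilon> a (x + ?e i)) = p + \<epsilon> * (\<Sum>k\<in>UNIV. q k)"
      unfolding p_def q_def
      by (subst sum.swap) (simp add: euler_step_def shift_sum_def distrib_left sum.distrib sum_distrib_left mult_ac)
    have e3: "(\<Sum>i\<in>UNIV. \<Sum>j\<in>UNIV. v i * v j * euler_step \<epsilon> a (x + ?e i + ?e j)) = Q + \<epsilon> * (\<Sum>k\<in>UNIV. Qk k)"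
    proof -
      have "(\<Sum>k\<in>UNIV. Qk k) = (\<Sum>i\<in>UNIV. \<Sum>k\<in>UNIV. \<Sum>j\<in>UNIV. v i * v j * a (x + ?e k + ?e i + ?e j))"
        unfolding Qk_def by (rule sum.swap)
      also have "\<dots> = (\<Sum>i\<in>UNIV. \<Sum>j\<in>UNIV. \<Sum>k\<in>UNIV. v i * v j * a (x + ?e k + ?e i + ?e j))"
        by (intro sum.cong refl sum.swap)
      also have "\<dots> = (\<Sum>i\<in>UNIV. \<Sum>j\<in>UNIV. v i * v j * shift_sum a (x + ?e i + ?e j))"
        by (simp add: shift_sum_def sum_distrib_left add_ac)
      finally have *: "(\<Sum>k\<in>UNIV. Qk k) = \<dots>" .
      show ?thesis unfolding *
        by (simp add: Q_def euler_step_def distrib_left sum.distrib sum_distrib_left mult_ac)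
    qed
    show ?thesis using main unfolding e1 e2 e3 .
  qed
qed

section \<open>The exponential of the shift operator as a limit of Euler steps\<close>

lemma binomial_scaled_tendsto: "(\<lambda>N. real (N choose m) * (s / real N) ^ m) \<longlonglongrightarrow> s ^ m / fact m"
proof -
  have eq: "real (N choose m) * (s / real N) ^ m = (\<Prod>i<m. (real N - real i) / real N) * (s ^ m / fact m)" for N
    by (simp add: binomial_gbinomial gbinomial_prod_rev prod_dividef power_divide atLeast0LessThan)
  have "(\<lambda>N. (real N - real i) / real N) \<longlonglongrightarrow> 1" for i
    by real_asymp
  then have "(\<lambda>N. (\<Prod>i<m. (real N - real i) / real N) * (s ^ m / fact m)) \<longlonglongrightarrow> (\<Prod>i<m. 1) * (s ^ m / fact m)"
    by (intro tendsto_intros)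
  then show ?thesis by (simp add: eq)
qed

lemma shift_sum_sum: "shift_sum (\<lambda>x. \<Sum>m\<in>M. c m * g m x) x = (\<Sum>m\<in>M. c m * shift_sum (g m) x)"
  unfolding shift_sum_def by (subst sum.swap) (simp add: sum_distrib_left)

lemma euler_step_iter:
  "(euler_step \<epsilon> ^^ N) a x = (\<Sum>m\<le>N. real (N choose m) * \<epsilon> ^ m * (shift_sum ^^ m) a x)"
proof (induction N arbitrary: x)
  case 0
  then show ?case by simp
next
  case (Suc N)
  let ?g = "\<lambda>m. (shift_sum ^^ m) a x"
  have IH: "(euler_step \<epsilon> ^^ N) a = (\<lambda>x. \<Sum>m\<le>N. real (N choose m) * \<epsilon> ^ m * (shift_sum ^^ m) a x)"
    using Suc by blast
  have "(euler_step \<epsilon> ^^ Suc N) a x = (\<Sum>m\<le>N. real (N choose m) * \<epsilon> ^ m * ?g m)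
      + \<epsilon> * (\<Sum>m\<le>N. real (N choose m) * \<epsilon> ^ m * ?g (Suc m))"
    by (simp add: IH euler_step_def shift_sum_sum)
  also have "(\<Sum>m\<le>N. real (N choose m) * \<epsilon> ^ m * ?g m) = (\<Sum>m\<le>Suc N. real (N choose m) * \<epsilon> ^ m * ?g m)"
    by simp
  also have "\<dots> = ?g 0 + (\<Sum>m\<le>N. real (N choose Suc m) * \<epsilon> ^ Suc m * ?g (Suc m))"
    by (subst sum.atMost_Suc_shift) simp
  also have "\<dots> + \<epsilon> * (\<Sum>m\<le>N. real (N choose m) * \<epsilon> ^ m * ?g (Suc m))
      = ?g 0 + (\<Sum>m\<le>N. real (Suc N choose Suc m) * \<epsilon> ^ Suc m * ?g (Suc m))"
    by (simp add: sum_distrib_left sum.distrib algebra_simps)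
  also have "\<dots> = (\<Sum>m\<le>Suc N. real (Suc N choose m) * \<epsilon> ^ m * ?g m)"
    by (subst sum.atMost_Suc_shift) simp
  finally show ?case .
qed

text \<open>By nilpotency the binomial expansion has the fixed length \<open>K\<close> once
  \<open>N\<close> is at least \<open>K\<close>, so the limit may be taken term by term.\<close>

lemma euler_step_iter_tendsto:
  assumes "weight K a"
  shows "(\<lambda>N. (euler_step (s / real N) ^^ N) a x) \<longlonglongrightarrow> shift_exp K s a x"
proof -
  have "(\<Sum>m<K. real (N choose m) * (s / real N) ^ m * (shift_sum ^^ m) a x) = (euler_step (s / real N) ^^ N) a x"
    if "K \<le> N" for N
    unfolding euler_step_iter
    by (rule sum.mono_neutral_left) (use that in \<open>auto simp: shift_sum_iter_deg[OF assms]\<close>)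
  moreover have "(\<lambda>N. \<Sum>m<K. real (N choose m) * (s / real N) ^ m * (shift_sum ^^ m) a x) \<longlonglongrightarrow> shift_exp K s a x"
    unfolding shift_exp_def by (intro tendsto_intros binomial_scaled_tendsto)
  ultimately show ?thesis
    by (rule_tac Lim_transform_eventually) (auto intro: eventually_sequentiallyI)
qed

text \<open>Supplies the constant that limits the step size in \<open>log_conc_euler_step\<close>.
  The support is finite, so the sum of all the ratios dominates each of them.\<close>

lemma shift_sum_bounded:
  assumes "weight K a"
  obtains R where "R \<ge> 0" "\<And>x. shift_sum a x \<le> R * a x"
proof
  let ?X = "{x. deg x < K}"
  let ?R = "\<Sum>x\<in>?X. shift_sum a x / a x"
  have nn: "0 \<le> shift_sum a x / a x" for x
    using weightD(1)[OF assms] weightD(1)[OF weight_shift_sum[OF assms]] by simp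
  show "0 \<le> ?R" by (intro sum_nonneg nn)
  show "shift_sum a x \<le> ?R * a x" for x
  proof (cases "a x = 0")
    case True
    then show ?thesis using shift_sum_eq_0[OF assms] by simp
  next
    case False
    then have "x \<in> ?X" using weightD(3)[OF assms, of x] by (cases "K \<le> deg x") auto
    then have "shift_sum a x / a x \<le> ?R"
      by (intro member_le_sum nn finite_deg_less)
    then show ?thesis using False weightD(1)[OF assms, of x] by (simp add: field_simps)
  qed
qed

text \<open>\<open>T\<close> commutes with an Euler step, so one bound \<open>R\<close> serves along
  the whole iteration and the step \<open>s / N\<close> is admissible as soon as
  \<open>s * R \<le> N\<close>. The defining inequalities of \<open>log_conc\<close> are closed
  under pointwise limits.\<close>

lemma log_conc_shift_exp:
  assumes w: "weight K a" and lc: "log_conc a" and s: "s \<ge> 0"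
  shows "log_conc (shift_exp K s a)"
proof -
  obtain R where R0: "R \<ge> 0" and R: "\<And>x. shift_sum a x \<le> R * a x"
    using shift_sum_bounded[OF w] by blast
  have iter: "weight K ((euler_step \<epsilon> ^^ N) a) \<and> log_conc ((euler_step \<epsilon> ^^ N) a)
      \<and> (\<forall>x. shift_sum ((euler_step \<epsilon> ^^ N) a) x \<le> R * (euler_step \<epsilon> ^^ N) a x)"
    if \<epsilon>: "\<epsilon> \<ge> 0" "\<epsilon> * R \<le> 1" for \<epsilon> N
  proof (induction N)
    case 0
    then show ?case using w lc R by simp
  next
    case (Suc N)
    let ?c = "(euler_step \<epsilon> ^^ N) a"
    have "shift_sum (euler_step \<epsilon> ?c) x \<le> R * euler_step \<epsilon> ?c x" for x
    proof -
      have "shift_sum (shift_sum ?c) x \<le> R * shift_sum ?c x"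
        using Suc unfolding shift_sum_def[of "shift_sum ?c"] shift_sum_def[of ?c x] sum_distrib_left
        by (intro sum_mono) auto
      then have "shift_sum ?c x + \<epsilon> * shift_sum (shift_sum ?c) x \<le> R * ?c x + \<epsilon> * (R * shift_sum ?c x)"
        using Suc \<epsilon> by (intro add_mono mult_left_mono) auto
      moreover have "shift_sum (euler_step \<epsilon> ?c) x = shift_sum ?c x + \<epsilon> * shift_sum (shift_sum ?c) x"
        by (simp add: euler_step_def shift_sum_def sum.distrib sum_distrib_left)
      ultimately show ?thesis by (simp add: euler_step_def algebra_simps)
    qed
    then show ?case
      using Suc \<epsilon> by (auto intro: weight_euler_step log_conc_euler_step[where R = R])
  qed
  let ?c = "\<lambda>N. (euler_step (s / real N) ^^ N) a"
  have ev: "eventually (\<lambda>N. log_conc (?c N)) sequentially"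
  proof -
    obtain N0 where N0: "s * R \<le> real N0" using real_arch_simple by blast
    show ?thesis
    proof (rule eventually_sequentiallyI[of "max N0 1"])
      fix N assume "max N0 1 \<le> N"
      then have "s * R \<le> real N" "N > 0" using N0 by auto
      then show "log_conc (?c N)" using iter[of "s / real N" N] s by (simp add: field_simps)
    qed
  qed
  show ?thesis unfolding log_conc_def
  proof (intro allI)
    fix x :: "nat ^ 'a" and v :: "'a \<Rightarrow> real"
    have "eventually (\<lambda>N. ?c N x * (\<Sum>i\<in>UNIV. \<Sum>j\<in>UNIV. v i * v j * ?c N (x + axis i 1 + axis j 1))
     \<le> (\<Sum>i\<in>UNIV. v i * ?c N (x + axis i 1))\<^sup>2) sequentially"
      using ev by eventually_elim (auto simp: log_conc_def)
    then show "shift_exp K s a x * (\<Sum>i\<in>UNIV. \<Sum>j\<in>UNIV. v i * v j * shift_exp K s a (x + axis i 1 + axis j 1))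
     \<le> (\<Sum>i\<in>UNIV. v i * shift_exp K s a (x + axis i 1))\<^sup>2"
      by (rule tendsto_le[rotated 3])
        (auto intro!: tendsto_intros euler_step_iter_tendsto[OF w])
  qed
qed

lemma shift_exp_deriv:
  assumes w: "weight K a"
  shows "((\<lambda>s. shift_exp K s a x) has_real_derivative shift_sum (shift_exp K s a) x) (at s)"
proof -
  let ?g = "\<lambda>m. (shift_sum ^^ m) a x"
  have 1: "((\<lambda>s. s ^ m / fact m * ?g m) has_real_derivative (real m * s ^ (m - 1) / fact m * ?g m)) (at s)" for m
    by (auto intro!: derivative_eq_intros simp: One_nat_def)
  have eq: "(\<Sum>m<K. real m * s ^ (m - 1) / fact m * ?g m) = shift_sum (shift_exp K s a) x"
  proof -
    \<comment> \<open>The extra term \<open>m = K\<close> is zero by nilpotency; it makes room for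
      the index shift caused by differentiation.\<close>
    have "(\<Sum>m<K. real m * s ^ (m - 1) / fact m * ?g m) = (\<Sum>m<Suc K. real m * s ^ (m - 1) / fact m * ?g m)"
      using shift_sum_iter_deg[OF w, of x K] by simp
    also have "\<dots> = (\<Sum>m<K. real (Suc m) * s ^ m / fact (Suc m) * ?g (Suc m))"
      by (subst sum.lessThan_Suc_shift) simp
    also have "\<dots> = (\<Sum>m<K. s ^ m / fact m * ?g (Suc m))"
      by (intro sum.cong refl) (simp add: divide_simps del: of_nat_Suc funpow.simps)
    also have "\<dots> = shift_sum (shift_exp K s a) x"
      unfolding shift_exp_def shift_sum_sum by simp
    finally show ?thesis .
  qed
  have "((\<lambda>s. \<Sum>m<K. s ^ m / fact m * ?g m) has_real_derivative
      (\<Sum>m<K. real m * s ^ (m - 1) / fact m * ?g m)) (at s)"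
    by (intro DERIV_sum 1)
  then show ?thesis
    unfolding eq by (simp add: shift_exp_def[abs_def])
qed

lemma shift_exp_eq_0: "weight K a \<Longrightarrow> a x = 0 \<Longrightarrow> shift_exp K s a x = 0"
  by (simp add: shift_exp_def shift_sum_iter_eq_0)

lemma shift_exp_pos:
  assumes w: "weight K a" and "a x \<noteq> 0" "s \<ge> 0"
  shows "shift_exp K s a x > 0"
proof -
  have K: "0 < K" using weightD(3)[OF w, of x] assms by (cases K) auto
  have "0 < s ^ 0 / fact 0 * (shift_sum ^^ 0) a x"
    using assms weightD(1)[OF w, of x] by simp
  also have "\<dots> \<le> shift_exp K s a x"
    unfolding shift_exp_def
    by (rule member_le_sum) (use K assms weightD(1)[OF weight_shift_sum_iter[OF w]] in auto)
  finally show ?thesis .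
qed

lemma shift_exp_0 [simp]: "weight K a \<Longrightarrow> shift_exp K 0 a = a"
proof
  fix x assume w: "weight K a"
  show "shift_exp K 0 a x = a x"
  proof (cases K)
    case 0
    then show ?thesis using weightD(3)[OF w] by (simp add: shift_exp_def)
  next
    case (Suc n)
    then show ?thesis unfolding shift_exp_def by (simp add: sum.lessThan_Suc_shift del: funpow.simps sum.lessThan_Suc)
  qed
qed

section \<open>Sums against the thinning kernel\<close>

text \<open>\<open>\<Sum>\<^sub>x t^|x| g(x) / x!\<close>, over a range that contains the support of every \<open>g\<close> of interest.\<close>
definition kernel_sum :: "nat \<Rightarrow> real \<Rightarrow> (nat ^ 'd::finite \<Rightarrow> real) \<Rightarrow> real" where
  "kernel_sum K t g = (\<Sum>x | deg x < K. t ^ deg x / real (vfact x) * g x)"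

text \<open>Summation by parts: split \<open>deg x\<close> into its coordinates and cancel each
  coordinate against the factorial, which moves the sum from \<open>x\<close> to
  \<open>x - axis i 1\<close>. Thus differentiating the kernel in \<open>t\<close> amounts to
  applying \<open>T\<close> to \<open>g\<close>.\<close>

lemma kernel_sum_shift:
  assumes "\<And>x. K \<le> deg x \<Longrightarrow> g x = 0"
  shows "(\<Sum>x | deg x < K. real (deg x) * t ^ (deg x - 1) / real (vfact x) * g x) = kernel_sum K t (shift_sum g)"
proof -
  let ?X = "{x :: nat ^ 'a. deg x < K}"
  have *: "(\<Sum>x\<in>?X. real (x $ i) * t ^ (deg x - 1) / real (vfact x) * g x)
      = (\<Sum>x\<in>?X. t ^ deg x / real (vfact x) * g (x + axis i 1))" for i
  proof -
    have "(\<Sum>x\<in>?X. real (x $ i) * t ^ (deg x - 1) / real (vfact x) * g x)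
      = (\<Sum>x\<in>{x\<in>?X. x $ i \<noteq> 0}. real (x $ i) * t ^ (deg x - 1) / real (vfact x) * g x)"
      by (rule sum.mono_neutral_right) (auto simp: finite_deg_less)
    also have "\<dots> = (\<Sum>x\<in>{x. Suc (deg x) < K}. t ^ deg x / real (vfact x) * g (x + axis i 1))"
    proof (rule sum.reindex_bij_witness[where i = "\<lambda>x. x + axis i 1" and j = "\<lambda>x. x - axis i 1"])
      fix x assume x: "x \<in> {x \<in> ?X. x $ i \<noteq> 0}"
      show e: "x - axis i 1 + axis i 1 = x"
        using x by (auto simp: vec_eq_iff axis_def)
      have "deg x = Suc (deg (x - axis i 1))" by (subst e[symmetric]) simp
      then show "x - axis i 1 \<in> {x. Suc (deg x) < K}" using x by auto
      have x': "x = (x - axis i 1) + axis i 1" using e by simp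
      show "t ^ deg (x - axis i 1) / real (vfact (x - axis i 1)) * g (x - axis i 1 + axis i 1) =
         real (x $ i) * t ^ (deg x - 1) / real (vfact x) * g x"
      proof -
        define y where "y = x - axis i 1"
        have xy: "x = y + axis i 1" using x' by (simp add: y_def)
        have "real (vfact (y + axis i 1)) = (real (y $ i) + 1) * real (vfact y)"
          by (simp add: vfact_add_axis algebra_simps)
        moreover have "real (y $ i) + 1 \<noteq> 0" using of_nat_0_le_iff[of "y $ i"] by linarith
        ultimately show ?thesis
          unfolding y_def[symmetric] unfolding xy by simp
      qed
    next
      fix x :: "nat ^ 'a" assume x: "x \<in> {x. Suc (deg x) < K}"
      show "x + axis i 1 - axis i 1 = x" by simp
      have "(x + axis i 1) $ i \<noteq> 0" by (simp add: axis_def)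
      then show "x + axis i 1 \<in> {x \<in> ?X. x $ i \<noteq> 0}" using x by simp
    qed
    also have "\<dots> = (\<Sum>x\<in>?X. t ^ deg x / real (vfact x) * g (x + axis i 1))"
      by (rule sum.mono_neutral_left) (auto simp: finite_deg_less intro!: assms)
    finally show ?thesis .
  qed
  have "(\<Sum>x\<in>?X. real (deg x) * t ^ (deg x - 1) / real (vfact x) * g x)
      = (\<Sum>x\<in>?X. \<Sum>i\<in>UNIV. real (x $ i) * t ^ (deg x - 1) / real (vfact x) * g x)"
  proof (intro sum.cong refl)
    fix x :: "nat ^ 'a"
    have "real (deg x) = (\<Sum>i\<in>UNIV. real (x $ i))" by (simp add: deg_def)
    then show "real (deg x) * t ^ (deg x - 1) / real (vfact x) * g x =
      (\<Sum>i\<in>UNIV. real (x $ i) * t ^ (deg x - 1) / real (vfact x) * g x)"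
      by (simp add: sum_distrib_right sum_divide_distrib)
  qed
  also have "\<dots> = (\<Sum>i\<in>UNIV. \<Sum>x\<in>?X. t ^ deg x / real (vfact x) * g (x + axis i 1))"
    by (subst sum.swap) (simp only: *)
  also have "\<dots> = kernel_sum K t (shift_sum g)"
    unfolding kernel_sum_def shift_sum_def by (subst sum.swap) (simp add: sum_distrib_left)
  finally show ?thesis .
qed

text \<open>The two contributions cancel when \<open>G\<close> evolves by \<open>- T\<close>; for
  other \<open>G\<close> the derivative measures the failure of that equation.\<close>

lemma kernel_sum_deriv:
  assumes "\<And>x. deg x < K \<Longrightarrow> ((\<lambda>t. G t x) has_real_derivative G' x) (at t)"
    and "\<And>x. K \<le> deg x \<Longrightarrow> G t x = 0"
  shows "((\<lambda>t. kernel_sum K t (G t)) has_real_derivative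
           kernel_sum K t (\<lambda>x. shift_sum (G t) x + G' x)) (at t)"
proof -
  have "((\<lambda>t. kernel_sum K t (G t)) has_real_derivative
      (\<Sum>x | deg x < K. real (deg x) * t ^ (deg x - 1) / real (vfact x) * G t x + t ^ deg x / real (vfact x) * G' x)) (at t)"
    unfolding kernel_sum_def
    by (intro DERIV_sum) (auto intro!: derivative_eq_intros assms(1) simp: One_nat_def add_divide_distrib mult_ac)
  also have "(\<Sum>x | deg x < K. real (deg x) * t ^ (deg x - 1) / real (vfact x) * G t x + t ^ deg x / real (vfact x) * G' x)
      = kernel_sum K t (\<lambda>x. shift_sum (G t) x + G' x)"
    using kernel_sum_shift[of K "G t" t] assms(2)
    by (simp add: kernel_sum_def distrib_left sum.distrib)
  finally show ?thesis .
qed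

text \<open>Complete thinning moves all mass to the origin, where \<open>0 ^ 0 = 1\<close>.\<close>

lemma kernel_sum_at_0:
  assumes "K > 0"
  shows "kernel_sum K 0 g = g 0"
proof -
  have "kernel_sum K 0 g = (\<Sum>x\<in>{0}. 0 ^ deg x / real (vfact x) * g x)"
    unfolding kernel_sum_def by (rule sum.mono_neutral_right) (use assms in \<open>auto simp: finite_deg_less zero_less_iff_neq_zero simp del: neq0_conv\<close>)
  then show ?thesis by (simp add: vfact_def)
qed

section \<open>The Wu functional and its monotonicity along thinning\<close>

text \<open>With \<open>b = a f\<close> this is \<open>a(x + e\<^sub>i) \<Psi>(f(x), \<nabla>\<^sub>i\<^sup>+ f(x))\<close>; it is \<open>0\<close> when \<open>a (x + e\<^sub>i) = b (x + e\<^sub>i) = 0\<close>.\<close>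
definition wu_term :: "(nat ^ 'd::finite \<Rightarrow> real) \<Rightarrow> (nat ^ 'd \<Rightarrow> real) \<Rightarrow> nat ^ 'd \<Rightarrow> 'd \<Rightarrow> real" where
  "wu_term a b x i =
     (let a' = a (x + axis i 1); b' = b (x + axis i 1)
      in b' * ln (b' * a x / (a' * b x)) - b' + a' * b x / a x)"

text \<open>
  \<open>C\<close> and \<open>D\<close> stand for \<open>A(x + e\<^sub>i + e\<^sub>j)\<close> and \<open>B(x + e\<^sub>i + e\<^sub>j)\<close>; the right-hand side is the \<open>(i, j)\<close>
  contribution to \<open>D'(t)\<close> at \<open>x\<close>. Minimising over \<open>D\<close>, at \<open>D = M\<close>, leaves the left-hand side exactly.
\<close>
lemma wu_pair_ge:
  fixes A B A\<^sub>i A\<^sub>j B\<^sub>i B\<^sub>j C D :: real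
  assumes pos: "A > 0" "B > 0" "A\<^sub>i > 0" "A\<^sub>j > 0" "B\<^sub>i > 0" "B\<^sub>j > 0" "C \<ge> 0" "D \<ge> 0" and CD: "C = 0 \<longleftrightarrow> D = 0"
  shows "B / A\<^sup>2 * ((B\<^sub>i * A / (A\<^sub>i * B) - 1) * (B\<^sub>j * A / (A\<^sub>j * B) - 1) * (A\<^sub>i * A\<^sub>j - A * C))
     \<le> (D * ln (D * A\<^sub>j / (C * B\<^sub>j)) - D + C * B\<^sub>j / A\<^sub>j)
       - (D * ln (B\<^sub>i * A / (A\<^sub>i * B)) + B\<^sub>i * (A\<^sub>j / A - C / A\<^sub>i - B\<^sub>j / B) + C * B / A + A\<^sub>i * B\<^sub>j / A - A\<^sub>i * B * A\<^sub>j / A\<^sup>2)"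
proof -
  define M where "M = C * B\<^sub>j * B\<^sub>i * A / (A\<^sub>j * A\<^sub>i * B)"
  have key: "D * ln (D * A\<^sub>j / (C * B\<^sub>j)) - D * ln (B\<^sub>i * A / (A\<^sub>i * B)) - D \<ge> - M"
  proof (cases "D = 0")
    case True
    then show ?thesis using CD by (simp add: M_def)
  next
    case False
    then have p: "C > 0" "D > 0" using CD pos by auto
    then have M: "M > 0" using pos by (simp add: M_def)
    have "ln (M / D) \<le> M / D - 1" using M p by (intro ln_le_minus_one) auto
    then have "D * ln (M / D) \<le> D * (M / D - 1)" using p by (intro mult_left_mono) auto
    also have "\<dots> = M - D" using p by (simp add: field_simps)
    also have "D * ln (M / D) = - (D * ln (D * A\<^sub>j / (C * B\<^sub>j)) - D * ln (B\<^sub>i * A / (A\<^sub>i * B)))"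
      using pos p by (simp add: M_def ln_mult ln_div algebra_simps)
    finally show ?thesis by linarith
  qed
  have "B / A\<^sup>2 * ((B\<^sub>i * A / (A\<^sub>i * B) - 1) * (B\<^sub>j * A / (A\<^sub>j * B) - 1) * (A\<^sub>i * A\<^sub>j - A * C))
    = - M + C * B\<^sub>j / A\<^sub>j - (B\<^sub>i * (A\<^sub>j / A - C / A\<^sub>i - B\<^sub>j / B) + C * B / A + A\<^sub>i * B\<^sub>j / A - A\<^sub>i * B * A\<^sub>j / A\<^sup>2)"
    using pos unfolding M_def by (simp add: divide_simps power2_eq_square) algebra
  then show ?thesis using key by linarith
qed

text \<open>Expanding every \<open>shift_sum\<close> into its summands introduces a second direction
  \<open>j\<close>, so that each pair \<open>(i, j)\<close> can be compared with the Wu term shifted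
  by \<open>axis j 1\<close>, as \<open>wu_pair_ge\<close> requires.\<close>

lemma wu_term_deriv:
  fixes A B :: "real \<Rightarrow> nat ^ 'd::finite \<Rightarrow> real"
  assumes dA: "\<And>x. ((\<lambda>t. A t x) has_real_derivative - shift_sum (A t) x) (at t)"
    and dB: "\<And>x. ((\<lambda>t. B t x) has_real_derivative - shift_sum (B t) x) (at t)"
    and pos: "A t x > 0" "B t x > 0" "A t (x + axis i 1) > 0" "B t (x + axis i 1) > 0"
  shows "((\<lambda>t. wu_term (A t) (B t) x i) has_real_derivative
     - (\<Sum>j\<in>UNIV. B t (x + axis i 1 + axis j 1) * ln (B t (x + axis i 1) * A t x / (A t (x + axis i 1) * B t x))
          + B t (x + axis i 1) * (A t (x + axis j 1) / A t x - A t (x + axis i 1 + axis j 1) / A t (x + axis i 1)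
              - B t (x + axis j 1) / B t x)
          + A t (x + axis i 1 + axis j 1) * B t x / A t x + A t (x + axis i 1) * B t (x + axis j 1) / A t x
          - A t (x + axis i 1) * B t x * A t (x + axis j 1) / (A t x)\<^sup>2)) (at t)"
    (is "(_ has_real_derivative - (\<Sum>j\<in>UNIV. ?s j)) _")
proof -
  define a b a' b' where "a = A t x" and "b = B t x" and "a' = A t (x + axis i 1)" and "b' = B t (x + axis i 1)"
  define sa sb sa' sb' where "sa = shift_sum (A t) x" and "sb = shift_sum (B t) x"
    and "sa' = shift_sum (A t) (x + axis i 1)" and "sb' = shift_sum (B t) (x + axis i 1)"
  have p: "a > 0" "b > 0" "a' > 0" "b' > 0" using pos by (simp_all add: a_def b_def a'_def b'_def)
  have "((\<lambda>t. B t (x + axis i 1) * ln (B t (x + axis i 1) * A t x / (A t (x + axis i 1) * B t x))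
      - B t (x + axis i 1) + A t (x + axis i 1) * B t x / A t x) has_real_derivative
    - (sb' * ln (b' * a / (a' * b)) + b' * (sa / a - sa' / a' - sb / b) + sa' * b / a + a' * sb / a - a' * b * sa / a\<^sup>2)) (at t)"
    apply (rule derivative_eq_intros dA dB refl | (use pos in simp; fail))+
    unfolding a_def[symmetric] b_def[symmetric] a'_def[symmetric] b'_def[symmetric]
      sa_def[symmetric] sb_def[symmetric] sa'_def[symmetric] sb'_def[symmetric]
    using p by (simp add: field_simps power2_eq_square)
  moreover have "(\<Sum>j\<in>UNIV. ?s j) = sb' * ln (b' * a / (a' * b)) + b' * (sa / a - sa' / a' - sb / b) + sa' * b / a + a' * sb / a - a' * b * sa / a\<^sup>2"
    unfolding sa_def sb_def sa'_def sb'_def shift_sum_def a_def[symmetric] b_def[symmetric] a'_def[symmetric] b'_def[symmetric]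
    by (simp add: sum.distrib sum_subtractf flip: sum_distrib_left sum_distrib_right sum_divide_distrib)
  ultimately show ?thesis by (simp add: wu_term_def Let_def)
qed

text \<open>The thinning argument for unnormalised weights, with \<open>b\<close> in the role of
  \<open>a f\<close>. Truncation destroys total mass one, hence the quotient of masses inside the
  logarithm.\<close>

lemma entropy_kernel_le:
  fixes a b :: "nat ^ 'd::finite \<Rightarrow> real"
  assumes wa: "weight K a" and wb: "weight K b" and ab: "\<And>x. a x = 0 \<longleftrightarrow> b x = 0"
    and lc: "log_conc a" and K: "K > 0"
  shows "kernel_sum K 1 (\<lambda>x. b x * ln (b x / a x))
      - kernel_sum K 1 b * ln (kernel_sum K 1 b / kernel_sum K 1 a)
    \<le> kernel_sum K 1 (\<lambda>x. \<Sum>i\<in>UNIV. wu_term a b x i)"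
proof -
  define A where "A t = shift_exp K (1 - t) a" for t
  define B where "B t = shift_exp K (1 - t) b" for t
  let ?e = "\<lambda>i::'d. axis i (1::nat)"
  have dA: "((\<lambda>t. A t x) has_real_derivative - shift_sum (A t) x) (at t)" for t x
    unfolding A_def by (rule DERIV_chain2[OF shift_exp_deriv[OF wa], THEN DERIV_cong])
      (auto intro!: derivative_eq_intros)
  have dB: "((\<lambda>t. B t x) has_real_derivative - shift_sum (B t) x) (at t)" for t x
    unfolding B_def by (rule DERIV_chain2[OF shift_exp_deriv[OF wb], THEN DERIV_cong])
      (auto intro!: derivative_eq_intros)
  have A0: "A t x = 0" if "a x = 0" for t x
    using that shift_exp_eq_0[OF wa] by (simp add: A_def)
  have B0: "B t x = 0" if "a x = 0" for t x
    using that ab shift_exp_eq_0[OF wb] by (simp add: B_def)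
  have Apos: "A t x > 0" if "a x \<noteq> 0" "t \<le> 1" for t x
    using that shift_exp_pos[OF wa] by (simp add: A_def)
  have Bpos: "B t x > 0" if "a x \<noteq> 0" "t \<le> 1" for t x
    using that ab shift_exp_pos[OF wb] by (simp add: B_def)
  have a_up: "a (x + ?e i) = 0" if "a x = 0" for x i using weightD(2)[OF wa that] .
  have a_deg: "a x = 0" if "K \<le> deg x" for x using weightD(3)[OF wa that] .

  \<comment> \<open>Thinning preserves total mass, because the derivative of the kernel and that of
    \<open>exp((1 - t) T) c\<close> cancel. Comparing \<open>t = 1\<close> with \<open>t = 0\<close>
    evaluates \<open>\<Phi> 0\<close> at the end.\<close>
  have mass: "kernel_sum K 1 c = shift_exp K 1 c 0" if w: "weight K c" for c :: "nat ^ 'd \<Rightarrow> real"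
  proof -
    have "((\<lambda>t. kernel_sum K t (shift_exp K (1 - t) c)) has_real_derivative 0) (at t)" for t
    proof (rule DERIV_cong[OF kernel_sum_deriv])
      show "((\<lambda>t. shift_exp K (1 - t) c x) has_real_derivative - shift_sum (shift_exp K (1 - t) c) x) (at t)" for x
        by (rule DERIV_chain2[OF shift_exp_deriv[OF w], THEN DERIV_cong]) (auto intro!: derivative_eq_intros)
      show "shift_exp K (1 - t) c x = 0" if "K \<le> deg x" for x
        using shift_exp_eq_0[OF w weightD(3)[OF w that]] .
    qed (simp add: kernel_sum_def)
    then have "kernel_sum K 1 (shift_exp K (1 - 1) c) = kernel_sum K 0 (shift_exp K (1 - 0) c)"
      by (rule DERIV_isconst_all[rule_format])
    then show ?thesis using kernel_sum_at_0[OF K] w by simp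
  qed

  define \<phi> where "\<phi> t x = B t x * ln (B t x / A t x)" for t x
  define G where "G t x = (\<Sum>i\<in>UNIV. wu_term (A t) (B t) x i)" for t x
  define \<Phi> where "\<Phi> t = kernel_sum K t (\<phi> t)" for t
  define D where "D t = kernel_sum K t (G t)" for t
  have wu0: "wu_term (A t) (B t) x i = 0" if "a (x + ?e i) = 0" for t x i
    using that by (simp add: wu_term_def A0 B0)
  have G0: "G t x = 0" if "a x = 0" for t x
    using that by (simp add: G_def wu0 a_up)

  have d\<Phi>: "(\<Phi> has_real_derivative D t) (at t)" if t: "t \<le> 1" for t
  proof -
    define \<phi>' where "\<phi>' x = (if a x = 0 then 0 else
      - (\<Sum>j\<in>UNIV. B t (x + ?e j) * ln (B t x / A t x) + B t (x + ?e j) - B t x / A t x * A t (x + ?e j)))" for x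
    have "(\<Phi> has_real_derivative kernel_sum K t (\<lambda>x. shift_sum (\<phi> t) x + \<phi>' x)) (at t)"
      unfolding \<Phi>_def
    proof (rule kernel_sum_deriv)
      show "\<phi> t x = 0" if "K \<le> deg x" for x
        using B0[OF a_deg[OF that]] by (simp add: \<phi>_def)
      show "((\<lambda>t. \<phi> t x) has_real_derivative \<phi>' x) (at t)" for x
      proof (cases "a x = 0")
        case True
        then show ?thesis by (simp add: \<phi>_def \<phi>'_def B0)
      next
        case False
        have p: "A t x > 0" "B t x > 0" using Apos Bpos False t by auto
        have "(\<Sum>j\<in>UNIV. B t (x + ?e j) * ln (B t x / A t x) + B t (x + ?e j) - B t x / A t x * A t (x + ?e j))
          = shift_sum (B t) x * ln (B t x / A t x) + shift_sum (B t) x - B t x / A t x * shift_sum (A t) x"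
          by (simp add: shift_sum_def sum.distrib sum_subtractf sum_distrib_left sum_distrib_right)
        then show ?thesis
          unfolding \<phi>_def \<phi>'_def using False
          apply simp
          apply (rule derivative_eq_intros dA dB refl | (use p in simp; fail))+
          using p by (simp add: field_simps power2_eq_square)
      qed
    qed
    \<comment> \<open>The shift brings in the logarithm of \<open>B t / A t\<close> at
      \<open>x + axis j 1\<close>, the time derivative removes the one at \<open>x\<close>;
      direction by direction the difference is the Wu term.\<close>
    moreover have "shift_sum (\<phi> t) x + \<phi>' x = G t x" for x
    proof (cases "a x = 0")
      case True
      then show ?thesis by (simp add: G0 \<phi>'_def shift_sum_def \<phi>_def B0 a_up)
    next
      case False
      have p: "A t x > 0" "B t x > 0" using Apos Bpos False t by auto
      have "\<phi> t (x + ?e j) - (B t (x + ?e j) * ln (B t x / A t x) + B t (x + ?e j) - B t x / A t x * A t (x + ?e j))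
        = wu_term (A t) (B t) x j" for j
      proof (cases "a (x + ?e j) = 0")
        case True
        then show ?thesis by (simp add: wu0 \<phi>_def A0 B0)
      next
        case False
        have p': "A t (x + ?e j) > 0" "B t (x + ?e j) > 0" using Apos Bpos False t by auto
        show ?thesis using p p' unfolding wu_term_def \<phi>_def Let_def
          by (simp add: ln_mult ln_div algebra_simps)
      qed
      then show ?thesis using False
        by (simp add: \<phi>'_def shift_sum_def G_def flip: sum_subtractf)
    qed
    ultimately show ?thesis by (simp add: D_def)
  qed

  have dD: "\<exists>y. (D has_real_derivative y) (at t) \<and> y \<ge> 0" if t: "0 \<le> t" "t \<le> 1" for t
  proof -
    define s where "s x i j = B t (x + ?e i + ?e j) * ln (B t (x + ?e i) * A t x / (A t (x + ?e i) * B t x))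
          + B t (x + ?e i) * (A t (x + ?e j) / A t x - A t (x + ?e i + ?e j) / A t (x + ?e i)
              - B t (x + ?e j) / B t x)
          + A t (x + ?e i + ?e j) * B t x / A t x + A t (x + ?e i) * B t (x + ?e j) / A t x
          - A t (x + ?e i) * B t x * A t (x + ?e j) / (A t x)\<^sup>2" for x i j
    define g' where "g' x i = (if a (x + ?e i) = 0 then 0 else - (\<Sum>j\<in>UNIV. s x i j))" for x i
    have dG: "((\<lambda>t. G t x) has_real_derivative (\<Sum>i\<in>UNIV. g' x i)) (at t)" for x
      unfolding G_def
    proof (intro DERIV_sum)
      fix i
      show "((\<lambda>t. wu_term (A t) (B t) x i) has_real_derivative g' x i) (at t)"
      proof (cases "a (x + ?e i) = 0")
        case True
        then show ?thesis by (simp add: wu0 g'_def)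
      next
        case False
        then have "a x \<noteq> 0" using a_up by blast
        then show ?thesis using False t unfolding g'_def s_def
          by (simp only: if_False) (intro wu_term_deriv dA dB Apos Bpos)
      qed
    qed
    have lcA: "log_conc (A t)"
      unfolding A_def using log_conc_shift_exp[OF wa lc] t by simp
    have nn: "shift_sum (G t) x + (\<Sum>i\<in>UNIV. g' x i) \<ge> 0" for x
    proof (cases "a x = 0")
      case True
      then show ?thesis by (simp add: shift_sum_def G0 g'_def a_up)
    next
      case False
      have p: "A t x > 0" "B t x > 0" using Apos Bpos False t by auto
      \<comment> \<open>The relative increment of the conditional expectation
        \<open>B t / A t\<close> in direction \<open>i\<close> is the vector at which the ULC form
        is tested. Where \<open>x + axis i 1\<close> leaves the support, division by zero makes it
        \<open>- 1\<close>, which is harmless: all coefficients in that direction vanish.\<close>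
      define v where "v i = B t (x + ?e i) * A t x / (A t (x + ?e i) * B t x) - 1" for i
      have pair: "B t x / (A t x)\<^sup>2 * (v i * v j * (A t (x + ?e i) * A t (x + ?e j) - A t x * A t (x + ?e i + ?e j)))
        \<le> wu_term (A t) (B t) (x + ?e j) i - (if a (x + ?e i) = 0 then 0 else s x i j)" for i j
      proof -
        have comm: "x + ?e j + ?e i = x + ?e i + ?e j" by (simp add: add_ac)
        consider "a (x + ?e i) = 0" | "a (x + ?e i) \<noteq> 0" "a (x + ?e j) = 0" | "a (x + ?e i) \<noteq> 0" "a (x + ?e j) \<noteq> 0"
          by blast
        then show ?thesis
        proof cases
          case 1
          have z: "a (x + ?e j + ?e i) = 0" unfolding comm using 1 a_up by blast
          show ?thesis using 1 z unfolding comm by (simp add: wu0 comm A0)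
        next
          case 2
          have z: "a (x + ?e i + ?e j) = 0" unfolding comm[symmetric] using 2 a_up by blast
          have z': "wu_term (A t) (B t) (x + ?e j) i = 0" using z wu0 unfolding comm[symmetric] by blast
          show ?thesis unfolding z' using 2 z by (simp add: s_def A0 B0)
        next
          case 3
          have q: "A t (x + ?e i) > 0" "A t (x + ?e j) > 0" "B t (x + ?e i) > 0" "B t (x + ?e j) > 0"
            using 3 Apos Bpos t by auto
          have r: "A t (x + ?e i + ?e j) \<ge> 0 \<and> B t (x + ?e i + ?e j) \<ge> 0 \<and>
              (A t (x + ?e i + ?e j) = 0 \<longleftrightarrow> B t (x + ?e i + ?e j) = 0)"
            using A0[of "x + ?e i + ?e j" t] B0[of "x + ?e i + ?e j" t]
              Apos[of "x + ?e i + ?e j" t] Bpos[of "x + ?e i + ?e j" t] t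
            by (cases "a (x + ?e i + ?e j) = 0") auto
          show ?thesis
            using wu_pair_ge[of "A t x" "B t x" "A t (x + ?e i)" "A t (x + ?e j)"
                "B t (x + ?e i)" "B t (x + ?e j)" "A t (x + ?e i + ?e j)" "B t (x + ?e i + ?e j)"] p q r 3
            by (simp add: v_def wu_term_def Let_def comm s_def)
        qed
      qed
      let ?q = "\<lambda>i j. v i * v j * (A t (x + ?e i) * A t (x + ?e j) - A t x * A t (x + ?e i + ?e j))"
      have "0 \<le> (\<Sum>i\<in>UNIV. v i * A t (x + ?e i))\<^sup>2
          - A t x * (\<Sum>i\<in>UNIV. \<Sum>j\<in>UNIV. v i * v j * A t (x + ?e i + ?e j))"
        using lcA by (simp add: log_conc_def)
      also have "\<dots> = (\<Sum>i\<in>UNIV. \<Sum>j\<in>UNIV. ?q i j)"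
        by (simp add: power2_eq_square sum_product sum_distrib_left sum_subtractf algebra_simps)
      finally have "0 \<le> B t x / (A t x)\<^sup>2 * (\<Sum>i\<in>UNIV. \<Sum>j\<in>UNIV. ?q i j)"
        using p by (intro mult_nonneg_nonneg) auto
      also have "\<dots> = (\<Sum>i\<in>UNIV. \<Sum>j\<in>UNIV. B t x / (A t x)\<^sup>2 * ?q i j)"
        by (simp only: sum_distrib_left)
      also have "\<dots> \<le> (\<Sum>i\<in>UNIV. \<Sum>j\<in>UNIV. wu_term (A t) (B t) (x + ?e j) i - (if a (x + ?e i) = 0 then 0 else s x i j))"
        by (intro sum_mono pair)
      also have "\<dots> = (\<Sum>i\<in>UNIV. \<Sum>j\<in>UNIV. wu_term (A t) (B t) (x + ?e j) i) + (\<Sum>i\<in>UNIV. g' x i)"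
        unfolding g'_def by (auto simp: sum_subtractf simp flip: sum_negf intro!: sum.cong)
      also have "(\<Sum>i\<in>UNIV. \<Sum>j\<in>UNIV. wu_term (A t) (B t) (x + ?e j) i) = shift_sum (G t) x"
        unfolding shift_sum_def G_def by (rule sum.swap)
      finally show ?thesis .
    qed
    have "(D has_real_derivative kernel_sum K t (\<lambda>x. shift_sum (G t) x + (\<Sum>i\<in>UNIV. g' x i))) (at t)"
      unfolding D_def by (rule kernel_sum_deriv) (use dG G0 a_deg in auto)
    moreover have "kernel_sum K t (\<lambda>x. shift_sum (G t) x + (\<Sum>i\<in>UNIV. g' x i)) \<ge> 0"
      unfolding kernel_sum_def using nn t by (intro sum_nonneg mult_nonneg_nonneg) auto
    ultimately show ?thesis by blast
  qed
  \<comment> \<open>The mean value theorem stands in for integrating \<open>D\<close> over the unit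
    interval.\<close>
  obtain \<xi> where \<xi>: "0 < \<xi>" "\<xi> < 1" and mvt: "\<Phi> 1 - \<Phi> 0 = (1 - 0) * D \<xi>"
    using MVT2[of 0 1 \<Phi> D] d\<Phi> by auto
  have "D \<xi> \<le> D 1"
    by (rule DERIV_nonneg_imp_nondecreasing) (use \<xi> dD in auto)
  then have "\<Phi> 1 - \<Phi> 0 \<le> D 1" using mvt by simp
  moreover have "\<Phi> 1 = kernel_sum K 1 (\<lambda>x. b x * ln (b x / a x))"
    using wa wb by (simp add: \<Phi>_def \<phi>_def[abs_def] A_def B_def)
  moreover have "D 1 = kernel_sum K 1 (\<lambda>x. \<Sum>i\<in>UNIV. wu_term a b x i)"
    using wa wb by (simp add: D_def G_def[abs_def] A_def B_def)
  moreover have "\<Phi> 0 = kernel_sum K 1 b * ln (kernel_sum K 1 b / kernel_sum K 1 a)"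
    by (simp add: kernel_sum_at_0[OF K] \<Phi>_def \<phi>_def mass[OF wa] mass[OF wb] A_def B_def)
  ultimately show ?thesis by simp
qed

section \<open>Pointwise comparison of the Wu and Dirichlet integrands\<close>

text \<open>\<open>\<Psi> u (w - u)\<close> is the Bregman divergence of \<open>x ln x\<close> from
  \<open>u\<close> to \<open>w\<close>. Adding the divergence with \<open>u\<close> and
  \<open>w\<close> exchanged gives the product on the right, so both bounds say that a divergence is
  nonnegative.\<close>

lemma \<Psi>_bounds:
  assumes "u > 0" "w > 0"
  shows "0 \<le> \<Psi> u (w - u)" "\<Psi> u (w - u) \<le> (ln w - ln u) * (w - u)"
proof -
  have eq: "\<Psi> u (w - u) = w * (ln w - ln u) - (w - u)"
    by (simp add: \<Psi>_def algebra_simps)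
  have "w * ln (u / w) \<le> w * (u / w - 1)" "u * ln (w / u) \<le> u * (w / u - 1)"
    using assms by (intro mult_left_mono ln_le_minus_one; simp)+
  then have "w * (ln u - ln w) \<le> u - w" "u * (ln w - ln u) \<le> w - u"
    using assms by (simp_all add: ln_div right_diff_distrib)
  then show "0 \<le> \<Psi> u (w - u)" "\<Psi> u (w - u) \<le> (ln w - ln u) * (w - u)"
    unfolding eq by (simp_all add: algebra_simps)
qed

lemma rate_eq_0: "n + axis i 1 \<notin> set_pmf \<mu> \<Longrightarrow> rate \<mu> i n = 0"
  by (simp add: rate_def set_pmf_iff)

lemma rate_mult_\<Psi>_bounds:
  assumes "\<And>n. n \<in> set_pmf \<mu> \<Longrightarrow> f n > 0" "n \<in> set_pmf \<mu>"
  shows "0 \<le> rate \<mu> i n * \<Psi> (f n) (grad_plus i f n)"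
    and "rate \<mu> i n * \<Psi> (f n) (grad_plus i f n) \<le> rate \<mu> i n * grad_plus i (\<lambda>n. ln (f n)) n * grad_plus i f n"
proof -
  have "0 \<le> rate \<mu> i n * \<Psi> (f n) (grad_plus i f n) \<and>
     rate \<mu> i n * \<Psi> (f n) (grad_plus i f n) \<le> rate \<mu> i n * (grad_plus i (\<lambda>n. ln (f n)) n * grad_plus i f n)"
  proof (cases "n + axis i 1 \<in> set_pmf \<mu>")
    case True
    then have "f n > 0" "f (n + axis i 1) > 0" using assms by auto
    then show ?thesis
      using \<Psi>_bounds[of "f n" "f (n + axis i 1)"] rate_nonneg[of \<mu> i n]
      by (auto simp: grad_plus_def intro!: mult_left_mono mult_nonneg_nonneg)
  qed (simp add: rate_eq_0)
  then show "0 \<le> rate \<mu> i n * \<Psi> (f n) (grad_plus i f n)"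
    "rate \<mu> i n * \<Psi> (f n) (grad_plus i f n) \<le> rate \<mu> i n * grad_plus i (\<lambda>n. ln (f n)) n * grad_plus i f n"
    by (auto simp: mult.assoc)
qed

section \<open>Truncation by degree and its limit\<close>

definition trunc_weight :: "nat \<Rightarrow> (nat ^ 'd::finite) pmf \<Rightarrow> nat ^ 'd \<Rightarrow> real" where
  "trunc_weight K \<mu> x = (if deg x < K then fact_weight \<mu> x else 0)"

lemma fact_weight_eq_0_iff: "fact_weight \<mu> x = 0 \<longleftrightarrow> x \<notin> set_pmf \<mu>"
  by (simp add: fact_weight_def set_pmf_iff)

lemma fact_weight_nonneg: "0 \<le> fact_weight \<mu> x"
  by (simp add: fact_weight_def)

lemma fact_weight_add_axis:
  assumes "downward_closed (set_pmf \<mu>)" "fact_weight \<mu> x = 0"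
  shows "fact_weight \<mu> (x + axis i 1) = 0"
proof -
  have "0 \<le> x" "x \<le> x + axis i 1" by (auto simp: less_eq_vec_def)
  then show ?thesis
    using assms unfolding fact_weight_eq_0_iff downward_closed_def by blast
qed

lemma trunc_weight_mult:
  assumes "downward_closed (set_pmf \<mu>)" "\<And>n. n \<in> set_pmf \<mu> \<Longrightarrow> f n > 0"
  shows "weight K (\<lambda>x. trunc_weight K \<mu> x * f x)"
    and "trunc_weight K \<mu> x = 0 \<longleftrightarrow> trunc_weight K \<mu> x * f x = 0"
proof -
  show iff: "trunc_weight K \<mu> x = 0 \<longleftrightarrow> trunc_weight K \<mu> x * f x = 0" for x
    using assms(2)[of x] by (auto simp: trunc_weight_def fact_weight_eq_0_iff)
  show "weight K (\<lambda>x. trunc_weight K \<mu> x * f x)"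
    unfolding weight_def iff[symmetric]
  proof (intro conjI allI impI)
    fix x
    show "0 \<le> trunc_weight K \<mu> x * f x"
      using assms(2)[of x] fact_weight_eq_0_iff[of \<mu> x] fact_weight_nonneg[of \<mu> x]
      by (cases "x \<in> set_pmf \<mu>") (auto simp: trunc_weight_def)
  qed (auto simp: trunc_weight_def fact_weight_add_axis[OF assms(1)] split: if_splits)
qed

lemma log_conc_trunc_weight:
  assumes "ULC \<mu>"
  shows "log_conc (trunc_weight K \<mu>)"
  unfolding log_conc_def
proof (intro allI)
  fix x :: "nat ^ 'a" and v :: "'a \<Rightarrow> real"
  let ?e = "\<lambda>i::'a. axis i (1::nat)" and ?w = "fact_weight \<mu>"
  have dc: "downward_closed (set_pmf \<mu>)" using assms by (simp add: ULC_def)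
  show "trunc_weight K \<mu> x * (\<Sum>i\<in>UNIV. \<Sum>j\<in>UNIV. v i * v j * trunc_weight K \<mu> (x + ?e i + ?e j))
    \<le> (\<Sum>i\<in>UNIV. v i * trunc_weight K \<mu> (x + ?e i))\<^sup>2"
  \<comment> \<open>If two further steps reach degree \<open>K\<close>, the second-order terms are
    cut off, so the left-hand side is zero. Otherwise no value involved is affected by the
    truncation.\<close>
  proof (cases "x \<in> set_pmf \<mu> \<and> Suc (Suc (deg x)) < K")
    case False
    then have "fact_weight \<mu> x = 0 \<or> \<not> Suc (Suc (deg x)) < K" by (simp add: fact_weight_eq_0_iff)
    then show ?thesis by (auto simp: trunc_weight_def)
  next
    case True
    define I where "I = up_dirs \<mu> x"
    have out: "?w (x + ?e i) = 0" if "i \<notin> I" for i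
      using that by (simp add: I_def up_dirs_def fact_weight_eq_0_iff)
    have out2: "?w (x + ?e i + ?e j) = 0" if "i \<notin> I \<or> j \<notin> I" for i j
      using that fact_weight_add_axis[OF dc out, of i j] fact_weight_add_axis[OF dc out, of j i]
      by (auto simp: add_ac)
    have "0 \<le> (\<Sum>i\<in>I. \<Sum>j\<in>I. (v i * ?w (x + ?e i)) * (1 - ?w x * ?w (x + ?e i + ?e j) / (?w (x + ?e i) * ?w (x + ?e j)))
        * (v j * ?w (x + ?e j)))"
      using assms True unfolding ULC_def psd_on_def I_def
      by (elim conjE ballE[of _ _ x]) (erule spec, simp)
    also have "\<dots> = (\<Sum>i\<in>I. \<Sum>j\<in>I. v i * ?w (x + ?e i) * (v j * ?w (x + ?e j)) - ?w x * (v i * v j * ?w (x + ?e i + ?e j)))"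
    proof (intro sum.cong refl)
      fix i j assume "i \<in> I" "j \<in> I"
      then have "?w (x + ?e i) \<noteq> 0" "?w (x + ?e j) \<noteq> 0"
        by (auto simp: I_def up_dirs_def fact_weight_eq_0_iff)
      then show "(v i * ?w (x + ?e i)) * (1 - ?w x * ?w (x + ?e i + ?e j) / (?w (x + ?e i) * ?w (x + ?e j)))
        * (v j * ?w (x + ?e j)) = v i * ?w (x + ?e i) * (v j * ?w (x + ?e j)) - ?w x * (v i * v j * ?w (x + ?e i + ?e j))"
        by (simp add: field_simps)
    qed
    also have "\<dots> = (\<Sum>i\<in>UNIV. \<Sum>j\<in>UNIV. v i * ?w (x + ?e i) * (v j * ?w (x + ?e j)) - ?w x * (v i * v j * ?w (x + ?e i + ?e j)))"
      by (rule sum.mono_neutral_cong_left)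
        (auto simp: out out2 intro!: sum.mono_neutral_cong_left)
    also have "\<dots> = (\<Sum>i\<in>UNIV. v i * ?w (x + ?e i))\<^sup>2 - ?w x * (\<Sum>i\<in>UNIV. \<Sum>j\<in>UNIV. v i * v j * ?w (x + ?e i + ?e j))"
      unfolding power2_eq_square sum_product by (simp add: sum_distrib_left sum_subtractf)
    finally show ?thesis using True by (simp add: trunc_weight_def)
  qed
qed

text \<open>At \<open>t = 1\<close> the kernel factor \<open>1 / x!\<close> undoes the factorial in
  \<open>fact_weight\<close>.\<close>

lemma kernel_sum_eq_expectation:
  assumes "\<And>x. deg x < K \<Longrightarrow> g x = fact_weight \<mu> x * h x"
  shows "kernel_sum K 1 g = measure_pmf.expectation \<mu> (\<lambda>x. indicator {x. deg x < K} x * h x)"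
proof -
  have "measure_pmf.expectation \<mu> (\<lambda>x. indicator {x. deg x < K} x * h x)
      = (\<Sum>x | deg x < K. indicator {x. deg x < K} x * h x * pmf \<mu> x)"
    by (rule integral_measure_pmf_real) (auto simp: finite_deg_less split: split_indicator_asm)
  also have "\<dots> = kernel_sum K 1 g"
    unfolding kernel_sum_def by (intro sum.cong refl) (simp add: assms fact_weight_def)
  finally show ?thesis ..
qed

lemma expectation_deg_less_tendsto:
  fixes h :: "nat ^ 'd::finite \<Rightarrow> real"
  assumes "integrable (measure_pmf \<mu>) h"
  shows "(\<lambda>K. measure_pmf.expectation \<mu> (\<lambda>x. indicator {x. deg x < K} x * h x)) \<longlonglongrightarrow> measure_pmf.expectation \<mu> h"
proof (rule integral_dominated_convergence[where w = "\<lambda>x. \<bar>h x\<bar>"])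
  show "AE x in measure_pmf \<mu>. (\<lambda>K. indicator {x. deg x < K} x * h x) \<longlonglongrightarrow> h x"
  proof (rule AE_I2)
    fix x
    have "eventually (\<lambda>K. indicator {x. deg x < K} x * h x = h x) sequentially"
      using eventually_gt_at_top[of "deg x"] by eventually_elim simp
    then show "(\<lambda>K. indicator {x. deg x < K} x * h x) \<longlonglongrightarrow> h x" by (rule tendsto_eventually)
  qed
qed (use assms in \<open>auto split: split_indicator\<close>)

theorem theorem4p22:
  fixes \<mu> :: "(nat ^ 'd::finite) pmf"
  assumes "ULC \<mu>" and "finite_first_moments \<mu>"
  shows "\<forall>f \<in> admissible \<mu>.
           integrable (measure_pmf \<mu>) (wu_integrand \<mu> f) \<and>
           Ent \<mu> f \<le> measure_pmf.expectation \<mu> (wu_integrand \<mu> f) \<and>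
           measure_pmf.expectation \<mu> (wu_integrand \<mu> f) \<le> dirichlet_form \<mu> (\<lambda>n. ln (f n)) f"
proof
  fix f assume f: "f \<in> admissible \<mu>"
  let ?E = "measure_pmf.expectation \<mu>" and ?L = "dirichlet_integrand \<mu> (\<lambda>n. ln (f n)) f"
  have dc: "downward_closed (set_pmf \<mu>)" using assms by (simp add: ULC_def)
  have fpos: "f n > 0" if "n \<in> set_pmf \<mu>" for n using f that by (simp add: admissible_def)
  note int = admissible_integrable[OF f]
  have wu: "0 \<le> wu_integrand \<mu> f n \<and> wu_integrand \<mu> f n \<le> ?L n" if "n \<in> set_pmf \<mu>" for n
    unfolding wu_integrand_def dirichlet_integrand_def
    using rate_mult_\<Psi>_bounds[of \<mu> f, OF fpos that] by (auto intro!: sum_nonneg sum_mono)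
  \<comment> \<open>Squeezed between zero and the integrable Dirichlet integrand.\<close>
  have int_wu: "integrable (measure_pmf \<mu>) (wu_integrand \<mu> f)"
    by (rule Bochner_Integration.integrable_bound[OF int(3)])
      (use wu in \<open>force simp: AE_measure_pmf_iff\<close>)+
  have upper: "?E (wu_integrand \<mu> f) \<le> dirichlet_form \<mu> (\<lambda>n. ln (f n)) f"
    unfolding dirichlet_form_def
    by (rule integral_mono_AE[OF int_wu int(3)]) (use wu in \<open>simp add: AE_measure_pmf_iff\<close>)
  let ?EK = "\<lambda>K h. ?E (\<lambda>x. indicator {x. deg x < K} x * h x)"
  have trunc: "?EK K (\<lambda>x. f x * ln (f x)) - ?EK K f * ln (?EK K f / ?EK K (\<lambda>_. 1)) \<le> ?E (wu_integrand \<mu> f)"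
    if K: "K > 0" for K
  proof -
    let ?a = "trunc_weight K \<mu>"
    let ?b = "\<lambda>x. ?a x * f x"
    \<comment> \<open>The cutoff is on \<open>Suc (deg x)\<close>: a jump counts only if its target
      is still below degree \<open>K\<close>, so the top layer contributes nothing.\<close>
    define h where "h x = (\<Sum>i\<in>UNIV. if Suc (deg x) < K then rate \<mu> i x * \<Psi> (f x) (grad_plus i f x) else 0)" for x
    have "weight K ?a" using trunc_weight_mult(1)[OF dc, of "\<lambda>_. 1" K] by simp
    moreover have "weight K ?b" "?a x = 0 \<longleftrightarrow> ?b x = 0" for x
      using trunc_weight_mult[OF dc, of f K] fpos by blast+
    ultimately have "kernel_sum K 1 (\<lambda>x. ?b x * ln (?b x / ?a x))
      - kernel_sum K 1 ?b * ln (kernel_sum K 1 ?b / kernel_sum K 1 ?a)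
      \<le> kernel_sum K 1 (\<lambda>x. \<Sum>i\<in>UNIV. wu_term ?a ?b x i)"
      by (rule entropy_kernel_le) (use log_conc_trunc_weight[OF assms(1)] K in auto)
    moreover have "kernel_sum K 1 (\<lambda>x. ?b x * ln (?b x / ?a x)) = ?EK K (\<lambda>x. f x * ln (f x))"
      by (rule kernel_sum_eq_expectation) (auto simp: trunc_weight_def)
    moreover have "kernel_sum K 1 ?b = ?EK K f"
      by (rule kernel_sum_eq_expectation) (auto simp: trunc_weight_def)
    moreover have "kernel_sum K 1 ?a = ?EK K (\<lambda>_. 1)"
      by (rule kernel_sum_eq_expectation) (auto simp: trunc_weight_def)
    moreover have "kernel_sum K 1 (\<lambda>x. \<Sum>i\<in>UNIV. wu_term ?a ?b x i) = ?EK K h"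
    proof (rule kernel_sum_eq_expectation)
      fix x :: "nat ^ 'd" assume x: "deg x < K"
      show "(\<Sum>i\<in>UNIV. wu_term ?a ?b x i) = fact_weight \<mu> x * h x"
        unfolding h_def sum_distrib_left
      proof (intro sum.cong refl)
        fix i
        show "wu_term ?a ?b x i
          = fact_weight \<mu> x * (if Suc (deg x) < K then rate \<mu> i x * \<Psi> (f x) (grad_plus i f x) else 0)"
        proof (cases "Suc (deg x) < K \<and> x + axis i 1 \<in> set_pmf \<mu>")
          case False
          then have "?a (x + axis i 1) = 0" by (auto simp: trunc_weight_def fact_weight_eq_0_iff)
          then show ?thesis using False by (auto simp: wu_term_def rate_eq_0)
        next
          case True
          then have supp: "x \<in> set_pmf \<mu>"
            using fact_weight_add_axis[OF dc, of x i] unfolding fact_weight_eq_0_iff by blast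
          define a a' where "a = fact_weight \<mu> x" and "a' = fact_weight \<mu> (x + axis i 1)"
          define u w where "u = f x" and "w = f (x + axis i 1)"
          have pos: "a > 0" "a' > 0" "u > 0" "w > 0"
            using True supp fpos fact_weight_nonneg[of \<mu> x] fact_weight_nonneg[of \<mu> "x + axis i 1"]
            by (auto simp: a_def a'_def u_def w_def less_le fact_weight_eq_0_iff)
          \<comment> \<open>The factor \<open>n_i + 1\<close> of the rate is the quotient of the two
            factorials.\<close>
          have "a * rate \<mu> i x = a'"
            using supp by (simp add: a_def a'_def fact_weight_def rate_def vfact_add_axis set_pmf_iff field_simps)
          moreover have "wu_term ?a ?b x i = a' * \<Psi> u (w - u)"
            using True x pos unfolding wu_term_def Let_def
            by (simp add: trunc_weight_def flip: a_def a'_def u_def w_def)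
              (simp add: \<Psi>_def ln_mult ln_div algebra_simps)
          ultimately show ?thesis
            using True by (simp add: grad_plus_def mult.assoc[symmetric] flip: a_def u_def w_def)
        qed
      qed
    qed
    \<comment> \<open>Truncation only drops nonnegative terms, so the bound is uniform in
      \<open>K\<close>.\<close>
    moreover have "?EK K h \<le> ?E (wu_integrand \<mu> f)"
    proof (rule integral_mono_AE)
      have h: "0 \<le> indicator {x. deg x < K} x * h x \<and> indicator {x. deg x < K} x * h x \<le> wu_integrand \<mu> f x"
        if "x \<in> set_pmf \<mu>" for x
        using wu[OF that] by (cases "Suc (deg x) < K") (auto simp: h_def wu_integrand_def split: split_indicator)
      show "integrable (measure_pmf \<mu>) (\<lambda>x. indicator {x. deg x < K} x * h x)"
        by (rule Bochner_Integration.integrable_bound[OF int_wu])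
          (use h in \<open>force simp: AE_measure_pmf_iff\<close>)+
      show "AE x in measure_pmf \<mu>. indicator {x. deg x < K} x * h x \<le> wu_integrand \<mu> f x"
        using h by (simp add: AE_measure_pmf_iff)
    qed (rule int_wu)
    ultimately show ?thesis by simp
  qed
  have Ef: "?E f > 0"
  proof -
    have "?E f \<noteq> 0"
    proof
      assume "?E f = 0"
      then have "AE x in measure_pmf \<mu>. f x = 0"
        by (subst (asm) integral_nonneg_eq_0_iff_AE[OF int(1)])
          (use fpos in \<open>auto simp: AE_measure_pmf_iff less_imp_le\<close>)
      then show False using fpos set_pmf_not_empty[of \<mu>] by (fastforce simp: AE_measure_pmf_iff)
    qed
    moreover have "?E f \<ge> 0"
      by (rule integral_nonneg_AE) (use fpos in \<open>auto simp: AE_measure_pmf_iff less_imp_le\<close>)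
    ultimately show ?thesis by simp
  qed
  \<comment> \<open>The truncated mass tends to one and \<open>?E f > 0\<close>, so the quotient and
    its logarithm are continuous at the limit.\<close>
  have "(\<lambda>K. ?EK K (\<lambda>x. f x * ln (f x)) - ?EK K f * ln (?EK K f / ?EK K (\<lambda>_. 1)))
      \<longlonglongrightarrow> ?E (\<lambda>x. f x * ln (f x)) - ?E f * ln (?E f / ?E (\<lambda>_. 1))"
    by (intro tendsto_intros expectation_deg_less_tendsto int) (use Ef in auto)
  then have "?E (\<lambda>x. f x * ln (f x)) - ?E f * ln (?E f / ?E (\<lambda>_. 1)) \<le> ?E (wu_integrand \<mu> f)"
    by (rule tendsto_upperbound[OF _ eventually_mono[OF eventually_gt_at_top[of 0] trunc]]) simp_all
  then have "Ent \<mu> f \<le> ?E (wu_integrand \<mu> f)"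
    by (simp add: Ent_def)
  then show "integrable (measure_pmf \<mu>) (wu_integrand \<mu> f) \<and> Ent \<mu> f \<le> ?E (wu_integrand \<mu> f) \<and>
      ?E (wu_integrand \<mu> f) \<le> dirichlet_form \<mu> (\<lambda>n. ln (f n)) f"
    using int_wu upper by blast
qed

end
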